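(* Let $V_{\mathrm{dG}}$ and $V_{\mathrm{cdG}}\subset V_{\mathrm{dG}}$ be the discontinuous Galerkin and continuous-discontinuous Galerkin finite element spaces defined in the context, let $\mathcal{B}$, $\mathcal{S}$, $\ell$ be the interior penalty form, the super-penalty form and the linear form for the problem $-\nabla\cdot(\mathbb{A}\nabla u)+b\cdot\nabla u+cu=f$ in $\Omega$, $u=0$ on $\partial\Omega$ (all defined in the context), and let $\mathcal{B}_\sigma:=\mathcal{B}+\sigma\mathcal{S}$ for $\sigma\ge0$. For each $\sigma\ge 0$ let $w_\sigma\in V_{\mathrm{dG}}$ be the dG finite element approximation, i.e. $$\mathcal{B}_\sigma(w_\sigma,w)=\ell(w)\qquad\text{for all } w\in V_{\mathrm{dG}},$$ and let $v_h\in V_{\mathrm{cdG}}$ be the cdG finite element approximation, i.e. $$\mathcal{B}_\sigma(v_h,v)=\ell(v)\qquad\text{for all } v\in V_{\mathrm{cdG}}$$ (this equation does not depend on $\sigma$, because $\mathcal{S}$ vanishes on $V_{\mathrm{cdG}}\times V_{\mathrm{cdG}}$). Then the dG approximation converges to the cdG approximation as $\sigma\to\infty$: $$\lim_{\sigma\to\infty}(w_\sigma-v_h)=0 .$$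
   Context: Mesh. $\Omega\subset\mathbb{R}^d$ is a bounded open polygonal domain and $\mathcal{T}_h$ is a fixed subdivision of $\Omega$ into open non-overlapping $d$-simplices $E$ of diameter $h_E$. $\mathcal{E}_h=\bigcup_{E\in\mathcal{T}_h}\partial E$ is the skeleton, identified with the set of faces; $\mathcal{E}_h^o=\mathcal{E}_h\setminus\partial\Omega$ are the interior faces and $\Gamma$ is the set of faces lying in $\partial\Omega$. For an interior face $e=\bar E^+\cap\bar E^-$, $h_e=\min(h_{E^+},h_{E^-})$; for a boundary face $e\subset\partial E$, $h_e=h_E$. $\mathcal{T}_h$ is decomposed into two disjoint parts $\mathcal{T}_{\mathrm{cG}}$ (continuous region) and $\mathcal{T}_{\mathrm{dG}}$ (discontinuous region). $\mathcal{E}_{\mathrm{dG}}$ is the skeleton of $\mathcal{T}_{\mathrm{dG}}$ (all faces of elements of $\mathcal{T}_{\mathrm{dG}}$, including those shared with $\mathcal{T}_{\mathrm{cG}}$), $\mathcal{E}_{\mathrm{cG}}=\mathcal{E}_h\setminus\mathcal{E}_{\mathrm{dG}}$, and $\Gamma_{\mathrm{cG}}$ is the set of boundary faces of elements of $\mathcal{T}_{\mathrm{cG}}$. Traces. For $e\in\mathcal{E}_h^o$, $\nu^\pm$ are the traces from $E^\pm$ and $n^\pm$ the outward normals of $E^\pm$ on $e$; for scalar $\nu$ and vector $\tau$: $\{\!\{\nu\}\!\}=\frac12(\nu^++\nu^-)$, $[\![\nu]\!]=\nu^+n^++\nu^-n^-$, $\{\!\{\tau\}\!\}=\frac12(\tau^++\tau^-)$.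 On $e\in\Gamma$: $\{\!\{\nu\}\!\}=\nu$, $[\![\nu]\!]=\nu n$, $\{\!\{\tau\}\!\}=\tau$, with $n$ the outward normal of $\Omega$. The sign of $b\cdot n$ is constant on each face. $\Gamma^{\mathrm{in}}$ is the set of boundary faces with $b\cdot n\le 0$. On an interior face, $\nu^{\mathrm{out}}$ denotes the trace from the downwind side, i.e. from the element into which $b$ points across $e$. $\nabla_h$ denotes the elementwise gradient (or divergence). Data. $b:\overline\Omega\to\mathbb{R}^d$ has Lipschitz continuous entries, $c\in L^\infty(\Omega)$, $f\in L^2(\Omega)$ are real valued, and $\mathbb{A}$ is a symmetric $d\times d$ matrix function on $\overline\Omega$ with bounded, piecewise continuous real entries and $\zeta^\top\mathbb{A}\zeta\ge0$ for all $\zeta\in\mathbb{R}^d$ a.e. in $\overline\Omega$ (traces of $\mathbb{A}$ on faces are taken from each element separately). It is assumed that $c-\frac12\nabla\cdot b\ge0$ a.e., and $c_0:=\sqrt{c-\frac12\nabla\cdot b}$. Spaces. With $\mathbb{P}^r$ the polynomials of degree at most $r$, $V_{\mathrm{dG}}=\{v\in L^2(\Omega): v|_E\in\mathbb{P}^r\ \forall E\in\mathcal{T}_h\}$, $V_{\mathrm{cdG}}=\{v\in L^2(\Omega): v|_E\in\mathbb{P}^r\ \forall E\in\mathcal{T}_h,\ v|_{\Gamma_{\mathrm{cG}}}=0,\ v|_{\mathcal{T}_{\mathrm{cG}}}\in C(\overline{\mathcal{T}}_{\mathrm{cG}})\}$, where $\overline{\mathcal{T}}_{\mathrm{cG}}$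 is the closure of the union of the elements of $\mathcal{T}_{\mathrm{cG}}$. $V_\perp$ is a subspace with $V_{\mathrm{dG}}=V_{\mathrm{cdG}}\oplus V_\perp$. Forms. Fix $\theta\in\{-1,0,1\}$, $C_p=C_p(\theta)\ge0$, and constants $C_{ar},C_d$ independent of $\sigma$. Let $\overline{\mathbb{A}}|_E=\|\,|\sqrt{\mathbb{A}}|_2\,\|_{L^\infty(E)}$ with $|\cdot|_2$ the matrix 2-norm, $m=C_p\{\!\{\overline{\mathbb{A}}r^2\}\!\}/h_e$ and $M=C_{ar}+C_d\{\!\{\overline{\mathbb{A}}r^2\}\!\}/h_e$ on each face $e$. For $w,\hat w\in V_{\mathrm{dG}}$ let $\mathcal{B}=\mathcal{B}_d+\mathcal{B}_{ar}$, $$\mathcal{B}_d(w,\hat w)=\sum_{E\in\mathcal{T}_h}\int_E\mathbb{A}\nabla_h w\cdot\nabla_h\hat w\,dx+\sum_{e\in\mathcal{E}_h}\int_e m[\![w]\!]\cdot[\![\hat w]\!]\,ds-\sum_{e\in\mathcal{E}_h}\int_e\big(\{\!\{\mathbb{A}\nabla_h w\}\!\}\cdot[\![\hat w]\!]-\theta\{\!\{\mathbb{A}\nabla_h\hat w\}\!\}\cdot[\![w]\!]\big)ds,$$ $$\mathcal{B}_{ar}(w,\hat w)=\sum_{E\in\mathcal{T}_h}\int_E\big((b\cdot\nabla_h w)\hat w+cw\hat w\big)dx-\sum_{e\in\mathcal{E}_h^o}\int_e b\cdot[\![w]\!]\,\hat w^{\mathrm{out}}ds-\sum_{e\in\Gamma^{\mathrm{in}}}\int_e(b\cdot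 n)w\hat w\,ds,$$ $$\mathcal{S}(w,\hat w)=\sum_{e\in\mathcal{E}_{\mathrm{cG}}}\int_e M[\![w]\!]\cdot[\![\hat w]\!]\,ds,\qquad \ell(w)=\sum_{E\in\mathcal{T}_h}\int_E fw\,dx .$$ Norms and standing assumptions. Let $$\|w\|_{\mathrm{dG}}^2=\sum_{E\in\mathcal{T}_h}\|\sqrt{\mathbb{A}}\nabla_h w\|_{L^2(E)}^2+\|c_0w\|_{L^2(\Omega)}^2+\sum_{e\in\mathcal{E}_h}\tfrac12\||b\cdot n|^{1/2}[\![w]\!]\|_{L^2(e)}^2+\sum_{e\in\mathcal{E}_h}\|\sqrt m[\![w]\!]\|_{L^2(e)}^2,$$ $$|w|_{\mathcal{S}}^2=\sum_{e\in\mathcal{E}_{\mathrm{cG}}}\|\sqrt M[\![w]\!]\|_{L^2(e)}^2 .$$ It is assumed that $M\ge 0$, that $\|\cdot\|_{\mathrm{dG}}$ is a norm on $V_{\mathrm{dG}}$, that $|\cdot|_{\mathcal{S}}$ is a norm on $V_\perp$, and that $C_p$ is sufficiently large in the sense that $\mathcal{B}$ is coercive: there is $\Lambda_W>0$ with $\mathcal{B}(w,w)\ge\Lambda_W\|w\|_{\mathrm{dG}}^2$ for all $w\in V_{\mathrm{dG}}$. *)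

theory Defs
  imports
    "HOL-Analysis.Analysis"
    "HOL-Probability.Essential_Supremum"
    "HOL-Library.Function_Algebras"
begin

section \<open>Function spaces\<close>

text \<open>Pointwise scaling turns functions into real vectors, so that the library's \<open>subspace\<close>
  applies to finite element spaces.\<close>

instantiation "fun" :: (type, scaleR) scaleR
begin
definition scaleR_fun :: "real \<Rightarrow> ('a \<Rightarrow> 'b) \<Rightarrow> 'a \<Rightarrow> 'b"
  where "scaleR_fun a f = (\<lambda>x. a *\<^sub>R f x)"
instance ..
end

instance "fun" :: (type, real_vector) real_vector
  by standard (simp_all add: scaleR_fun_def fun_eq_iff scaleR_add_right scaleR_add_left)

definition norm_on :: "'v::real_vector set \<Rightarrow> ('v \<Rightarrow> real) \<Rightarrow> bool"
  where "norm_on V N \<longleftrightarrow>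
    (\<forall>v\<in>V. 0 \<le> N v \<and> (N v = 0 \<longleftrightarrow> v = 0)) \<and>
    (\<forall>a. \<forall>v\<in>V. N (a *\<^sub>R v) = \<bar>a\<bar> * N v) \<and>
    (\<forall>u\<in>V. \<forall>v\<in>V. N (u + v) \<le> N u + N v)"

definition direct_sum :: "'v::real_vector set \<Rightarrow> 'v set \<Rightarrow> 'v set \<Rightarrow> bool"
  where "direct_sum V U W \<longleftrightarrow> V = {u + w |u w. u \<in> U \<and> w \<in> W} \<and> U \<inter> W = {0}"

definition square_integrable :: "(real^'n) set \<Rightarrow> (real^'n \<Rightarrow> real) \<Rightarrow> bool"
  where "square_integrable S g \<longleftrightarrow>
    g \<in> borel_measurable (lebesgue_on S) \<and> integrable (lebesgue_on S) (\<lambda>x. (g x)\<^sup>2)"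

definition essentially_bounded :: "(real^'n) set \<Rightarrow> (real^'n \<Rightarrow> real) \<Rightarrow> bool"
  where "essentially_bounded S g \<longleftrightarrow>
    g \<in> borel_measurable (lebesgue_on S) \<and> (\<exists>K. AE x in lebesgue_on S. \<bar>g x\<bar> \<le> K)"

definition Linf_norm :: "(real^'n) set \<Rightarrow> (real^'n \<Rightarrow> real) \<Rightarrow> real"
  where "Linf_norm S g = real_of_ereal (esssup (lebesgue_on S) (\<lambda>x. ereal \<bar>g x\<bar>))"

text \<open>Polynomials in \<open>d = CARD('n)\<close> variables of total degree at most \<open>r\<close>.\<close>

definition polys :: "nat \<Rightarrow> (real^'n::finite \<Rightarrow> real) set"
  where "polys r = range (\<lambda>a x. \<Sum>\<alpha> | sum \<alpha> UNIV \<le> r. a (\<alpha> :: 'n \<Rightarrow> nat) * (\<Prod>i\<in>UNIV. x $ i ^ \<alpha> i))"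


section \<open>Vector calculus\<close>

definition grad :: "(real^'n::finite \<Rightarrow> real) \<Rightarrow> real^'n \<Rightarrow> real^'n"
  where "grad v x = (\<chi> i. frechet_derivative v (at x) (axis i 1))"

definition divergence :: "(real^'n::finite \<Rightarrow> real^'n) \<Rightarrow> real^'n \<Rightarrow> real"
  where "divergence b x = trace (jacobian b (at x))"

definition psd :: "real^'n^'n::finite \<Rightarrow> bool"
  where "psd A \<longleftrightarrow> (\<forall>\<zeta>. 0 \<le> \<zeta> \<bullet> (A *v \<zeta>))"

text \<open>The positive semidefinite square root of a symmetric positive semidefinite matrix.\<close>

definition matrix_sqrt :: "real^'n^'n::finite \<Rightarrow> real^'n^'n"
  where "matrix_sqrt A = (THE R. transpose R = R \<and> psd R \<and> R ** R = A)"

text \<open>The trace at \<open>x \<in> closure E\<close> of a function given on \<open>E\<close>.\<close>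

definition trace_from :: "(real^'n) set \<Rightarrow> (real^'n \<Rightarrow> 'b::t2_space) \<Rightarrow> real^'n \<Rightarrow> 'b"
  where "trace_from E g x = Lim (at x within E) g"

text \<open>The \<open>(d-1)\<close>-dimensional Lebesgue measure on a closed convex set \<open>F\<close> spanning a hyperplane:
  points over \<open>F\<close> within distance \<open>1/2\<close> of the hyperplane form a prism of height one, whose
  \<open>d\<close>-dimensional measure is projected orthogonally to the hyperplane. For \<open>d = 1\<close> this is
  the unit point mass.\<close>

definition face_measure :: "(real^'n::finite) set \<Rightarrow> (real^'n) measure"
  where "face_measure F =
    distr (restrict_space lborel
        {y. infdist y (affine hull F) \<le> 1/2 \<and> closest_point (affine hull F) y \<in> F})
      (restrict_space borel F) (closest_point (affine hull F))"


section \<open>Simplicial subdivisions\<close>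

definition open_simplex :: "(real^'n::finite) set \<Rightarrow> bool"
  where "open_simplex E \<longleftrightarrow> (\<exists>K. int CARD('n) simplex K \<and> E = interior K)"

text \<open>Hanging nodes are allowed: a simplex need not meet another one in a common face.\<close>

definition subdivision :: "(real^'n::finite) set \<Rightarrow> (real^'n) set set \<Rightarrow> bool"
  where "subdivision \<Omega> T \<longleftrightarrow> finite T \<and> (\<forall>E\<in>T. open_simplex E) \<and> pairwise disjnt T \<and>
    \<Union>T \<subseteq> \<Omega> \<and> \<Omega> \<subseteq> (\<Union>E\<in>T. closure E)"

text \<open>Continuous on each piece of some subdivision of the domain, with continuous extension to
  the closed piece. The pieces need not be elements of the mesh.\<close>

definition piecewise_continuous :: "(real^'n::finite) set \<Rightarrow> (real^'n \<Rightarrow> real) \<Rightarrow> bool"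
  where "piecewise_continuous \<Omega> g \<longleftrightarrow>
    (\<exists>T. subdivision \<Omega> T \<and>
      (\<forall>E\<in>T. \<exists>g'. continuous_on (closure E) g' \<and> (\<forall>x\<in>E. g x = g' x)))"


section \<open>Mesh, data and faces\<close>

record ('n::finite) cdg =
  Omega :: "(real^'n) set"
  T_cG :: "(real^'n) set set"
  T_dG :: "(real^'n) set set"
  diff :: "real^'n \<Rightarrow> real^'n^'n"
  conv :: "real^'n \<Rightarrow> real^'n"
  reac :: "real^'n \<Rightarrow> real"
  source :: "real^'n \<Rightarrow> real"
  deg :: nat
  theta :: real
  C_p :: real
  C_ar :: real
  C_d :: real

definition T_h :: "('n::finite) cdg \<Rightarrow> (real^'n) set set"
  where "T_h D = T_cG D \<union> T_dG D"

text \<open>A face is stored with the set of elements from which traces on it are taken: two for an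
  interior face, one for a boundary face. If the domain lies on both sides of a piece of its
  boundary (a slit), that piece carries separate boundary faces for the two sides.\<close>

type_synonym 'n face = "(real^'n) set set \<times> (real^'n) set"

definition interior_faces :: "('n::finite) cdg \<Rightarrow> 'n face set"
  where "interior_faces D =
    {({E1, E2}, closure E1 \<inter> closure E2) |E1 E2.
      E1 \<in> T_h D \<and> E2 \<in> T_h D \<and> E1 \<noteq> E2 \<and>
      aff_dim (closure E1 \<inter> closure E2) = int CARD('n) - 1 \<and>
      rel_interior (closure E1 \<inter> closure E2) \<subseteq> Omega D}"

definition boundary_faces :: "('n::finite) cdg \<Rightarrow> 'n face set"
  where "boundary_faces D =
    {({E}, F) |E F. E \<in> T_h D \<and> F facet_of closure E \<and> F \<subseteq> frontier (Omega D)}"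

definition faces :: "('n::finite) cdg \<Rightarrow> 'n face set"
  where "faces D = interior_faces D \<union> boundary_faces D"

definition dG_faces :: "('n::finite) cdg \<Rightarrow> 'n face set"
  where "dG_faces D = {e \<in> faces D. fst e \<inter> T_dG D \<noteq> {}}"

definition cG_faces :: "('n::finite) cdg \<Rightarrow> 'n face set"
  where "cG_faces D = faces D - dG_faces D"

definition cG_boundary_faces :: "('n::finite) cdg \<Rightarrow> 'n face set"
  where "cG_boundary_faces D = {e \<in> boundary_faces D. fst e \<subseteq> T_cG D}"

definition outward_normal :: "(real^'n::finite) set \<Rightarrow> (real^'n) set \<Rightarrow> real^'n"
  where "outward_normal E F = (THE n. norm n = 1 \<and>
    (\<forall>x\<in>F. \<forall>y\<in>F. n \<bullet> (x - y) = 0) \<and> (\<forall>x\<in>E. \<forall>y\<in>F. n \<bullet> (x - y) < 0))"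

definition face_diameter :: "('n::finite) face \<Rightarrow> real"
  where "face_diameter e = Min (diameter ` fst e)"

definition inflow_faces :: "('n::finite) cdg \<Rightarrow> 'n face set"
  where "inflow_faces D = {e \<in> boundary_faces D.
    \<forall>E\<in>fst e. \<forall>x\<in>snd e. conv D x \<bullet> outward_normal E (snd e) \<le> 0}"

text \<open>Average and jump: since a face carries one or two elements, these cover interior and
  boundary faces uniformly. The argument \<open>g\<close> of \<open>average\<close> maps each element to the trace
  from that element.\<close>

definition average :: "('n::finite) face \<Rightarrow> ((real^'n) set \<Rightarrow> 'b::real_vector) \<Rightarrow> 'b"
  where "average e g = (\<Sum>E\<in>fst e. g E) /\<^sub>R real (card (fst e))"

definition jump :: "('n::finite) face \<Rightarrow> (real^'n \<Rightarrow> real) \<Rightarrow> real^'n \<Rightarrow> real^'n"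
  where "jump e v x = (\<Sum>E\<in>fst e. trace_from E v x *\<^sub>R outward_normal E (snd e))"

definition flux_average :: "('n::finite) cdg \<Rightarrow> 'n face \<Rightarrow> (real^'n \<Rightarrow> real) \<Rightarrow> real^'n \<Rightarrow> real^'n"
  where "flux_average D e v x =
    average e (\<lambda>E. trace_from E (diff D) x *v trace_from E (grad v) x)"

text \<open>The trace from the element into which the convection field points. Where the field is
  tangential there is none and the value is 0; in the bilinear form it is then multiplied by
  a vanishing factor.\<close>

definition downwind_trace :: "('n::finite) cdg \<Rightarrow> 'n face \<Rightarrow> (real^'n \<Rightarrow> real) \<Rightarrow> real^'n \<Rightarrow> real"
  where "downwind_trace D e v x =
    (\<Sum>E | E \<in> fst e \<and> conv D x \<bullet> outward_normal E (snd e) < 0. trace_from E v x)"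

definition elem_int :: "(real^'n::finite) set \<Rightarrow> (real^'n \<Rightarrow> real) \<Rightarrow> real"
  where "elem_int E g = integral\<^sup>L (lebesgue_on E) g"

definition face_int :: "('n::finite) face \<Rightarrow> (real^'n \<Rightarrow> real) \<Rightarrow> real"
  where "face_int e g = integral\<^sup>L (face_measure (snd e)) g"


section \<open>Finite element spaces\<close>

text \<open>Classes of functions modulo null sets are represented by the function that vanishes
  outside the open elements.\<close>

definition V_dG :: "('n::finite) cdg \<Rightarrow> (real^'n \<Rightarrow> real) set"
  where "V_dG D = {v. square_integrable (Omega D) v \<and>
    (\<forall>E\<in>T_h D. \<exists>p\<in>polys (deg D). \<forall>x\<in>E. v x = p x) \<and> (\<forall>x. x \<notin> \<Union>(T_h D) \<longrightarrow> v x = 0)}"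

definition V_cdG :: "('n::finite) cdg \<Rightarrow> (real^'n \<Rightarrow> real) set"
  where "V_cdG D = {v \<in> V_dG D.
    (\<forall>e\<in>cG_boundary_faces D. \<forall>E\<in>fst e. \<forall>x\<in>snd e. trace_from E v x = 0) \<and>
    (\<exists>g. continuous_on (closure (\<Union>(T_cG D))) g \<and> (\<forall>x\<in>\<Union>(T_cG D). v x = g x))}"


section \<open>Forms and norms\<close>

definition Abar :: "('n::finite) cdg \<Rightarrow> (real^'n) set \<Rightarrow> real"
  where "Abar D E = Linf_norm E (\<lambda>x. onorm ((*v) (matrix_sqrt (diff D x))))"

definition penalty_m :: "('n::finite) cdg \<Rightarrow> 'n face \<Rightarrow> real"
  where "penalty_m D e =
    C_p D * average e (\<lambda>E. Abar D E * (real (deg D))\<^sup>2) / face_diameter e"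

definition penalty_M :: "('n::finite) cdg \<Rightarrow> 'n face \<Rightarrow> real"
  where "penalty_M D e =
    C_ar D + C_d D * average e (\<lambda>E. Abar D E * (real (deg D))\<^sup>2) / face_diameter e"

definition form_d :: "('n::finite) cdg \<Rightarrow> (real^'n \<Rightarrow> real) \<Rightarrow> (real^'n \<Rightarrow> real) \<Rightarrow> real"
  where "form_d D w v =
    (\<Sum>E\<in>T_h D. elem_int E (\<lambda>x. (diff D x *v grad w x) \<bullet> grad v x))
    + (\<Sum>e\<in>faces D. face_int e (\<lambda>x. penalty_m D e * (jump e w x \<bullet> jump e v x)))
    - (\<Sum>e\<in>faces D. face_int e (\<lambda>x.
        flux_average D e w x \<bullet> jump e v x - theta D * (flux_average D e v x \<bullet> jump e w x)))"

definition form_ar :: "('n::finite) cdg \<Rightarrow> (real^'n \<Rightarrow> real) \<Rightarrow> (real^'n \<Rightarrow> real) \<Rightarrow> real"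
  where "form_ar D w v =
    (\<Sum>E\<in>T_h D. elem_int E (\<lambda>x. (conv D x \<bullet> grad w x) * v x + reac D x * w x * v x))
    - (\<Sum>e\<in>interior_faces D. face_int e (\<lambda>x.
        (conv D x \<bullet> jump e w x) * downwind_trace D e v x))
    - (\<Sum>e\<in>inflow_faces D. face_int e (\<lambda>x. \<Sum>E\<in>fst e.
        (conv D x \<bullet> outward_normal E (snd e)) * trace_from E w x * trace_from E v x))"

definition form_B :: "('n::finite) cdg \<Rightarrow> (real^'n \<Rightarrow> real) \<Rightarrow> (real^'n \<Rightarrow> real) \<Rightarrow> real"
  where "form_B D w v = form_d D w v + form_ar D w v"

definition form_S :: "('n::finite) cdg \<Rightarrow> (real^'n \<Rightarrow> real) \<Rightarrow> (real^'n \<Rightarrow> real) \<Rightarrow> real"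
  where "form_S D w v =
    (\<Sum>e\<in>cG_faces D. face_int e (\<lambda>x. penalty_M D e * (jump e w x \<bullet> jump e v x)))"

definition form_B_sigma ::
  "('n::finite) cdg \<Rightarrow> real \<Rightarrow> (real^'n \<Rightarrow> real) \<Rightarrow> (real^'n \<Rightarrow> real) \<Rightarrow> real"
  where "form_B_sigma D \<sigma> w v = form_B D w v + \<sigma> * form_S D w v"

definition form_l :: "('n::finite) cdg \<Rightarrow> (real^'n \<Rightarrow> real) \<Rightarrow> real"
  where "form_l D v = (\<Sum>E\<in>T_h D. elem_int E (\<lambda>x. source D x * v x))"

definition c_0 :: "('n::finite) cdg \<Rightarrow> real^'n \<Rightarrow> real"
  where "c_0 D x = sqrt (reac D x - divergence (conv D) x / 2)"

text \<open>On an interior face the two normals give the same absolute value of the normal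
  component, so that \<open>average\<close> merely selects it.\<close>

definition dG_norm :: "('n::finite) cdg \<Rightarrow> (real^'n \<Rightarrow> real) \<Rightarrow> real"
  where "dG_norm D w = sqrt (
    (\<Sum>E\<in>T_h D. elem_int E (\<lambda>x. (norm (matrix_sqrt (diff D x) *v grad w x))\<^sup>2))
    + elem_int (Omega D) (\<lambda>x. (c_0 D x * w x)\<^sup>2)
    + (\<Sum>e\<in>faces D. 1/2 * face_int e (\<lambda>x.
        (norm (sqrt (average e (\<lambda>E. \<bar>conv D x \<bullet> outward_normal E (snd e)\<bar>)) *\<^sub>R jump e w x))\<^sup>2))
    + (\<Sum>e\<in>faces D. face_int e (\<lambda>x. (norm (sqrt (penalty_m D e) *\<^sub>R jump e w x))\<^sup>2)))"

definition S_seminorm :: "('n::finite) cdg \<Rightarrow> (real^'n \<Rightarrow> real) \<Rightarrow> real"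
  where "S_seminorm D w = sqrt (\<Sum>e\<in>cG_faces D. face_int e (\<lambda>x.
    (norm (sqrt (penalty_M D e) *\<^sub>R jump e w x))\<^sup>2))"


section \<open>Standing assumptions on the mesh and the data\<close>

locale cdg_setting =
  fixes D :: "('n::finite) cdg"
  assumes domain: "open (Omega D)" "connected (Omega D)" "bounded (Omega D)" "Omega D \<noteq> {}"
    and mesh: "subdivision (Omega D) (T_h D)"
    and skeleton: "(\<Union>E\<in>T_h D. frontier E) = (\<Union>e\<in>faces D. snd e)"
    and regions: "T_cG D \<inter> T_dG D = {}"
    and b_Lipschitz: "\<And>i. \<exists>L. L-lipschitz_on (closure (Omega D)) (\<lambda>x. conv D x $ i)"
    and b_sign: "\<And>e E. e \<in> faces D \<Longrightarrow> E \<in> fst e \<Longrightarrow>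
      (\<forall>x\<in>snd e. conv D x \<bullet> outward_normal E (snd e) \<le> 0) \<or>
      (\<forall>x\<in>snd e. conv D x \<bullet> outward_normal E (snd e) \<ge> 0)"
    and c_bounded: "essentially_bounded (Omega D) (reac D)"
    and f_L2: "square_integrable (Omega D) (source D)"
    and A_symmetric: "\<And>x. x \<in> closure (Omega D) \<Longrightarrow> transpose (diff D x) = diff D x"
    and A_bounded: "\<And>i j. bounded ((\<lambda>x. diff D x $ i $ j) ` closure (Omega D))"
    and A_piecewise: "\<And>i j. piecewise_continuous (Omega D) (\<lambda>x. diff D x $ i $ j)"
    and A_psd: "AE x in lebesgue_on (closure (Omega D)). psd (diff D x)"
    and c_b: "AE x in lebesgue_on (Omega D). 0 \<le> reac D x - divergence (conv D) x / 2"
    and theta: "theta D \<in> {-1, 0, 1}"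
    and C_p: "0 \<le> C_p D"

end

theory Submission
  imports Defs
begin

text \<open>The error \<open>e = w \<sigma> - v_h\<close> is tested against itself. Put \<open>F v = \<ell> v - \<B> v_h v\<close>. This linear form vanishes
on \<open>V_cdG\<close>, because \<open>v_h\<close> solves the cdG problem and \<open>\<S>\<close> vanishes as soon as one of its arguments
lies in \<open>V_cdG\<close>. Writing \<open>e = u + p\<close> with \<open>u\<close> in \<open>V_cdG\<close> and \<open>p\<close> in \<open>V_perp\<close>, and \<open>t\<close> for the
\<open>\<S>\<close>-seminorm of \<open>p\<close>, one gets
\<open>\<B> e e + \<sigma> t\<^sup>2 = \<B> e e + \<sigma> \<S> e e = F e = F p \<le> C t \<le> \<sigma> t\<^sup>2 + C\<^sup>2 / (4 \<sigma>)\<close>,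
where \<open>C\<close> exists because the \<open>\<S>\<close>-seminorm is a norm on the finite-dimensional space \<open>V_perp\<close>. So
the penalty term cancels, coercivity makes the dG norm of \<open>e\<close> of order \<open>\<sigma>\<close> to the power \<open>-1/2\<close>, and
equivalence of norms on \<open>V_dG\<close> carries this over to any norm. This is \<open>penalty_limit\<close>,
which knows nothing about meshes.

To apply it, the concrete forms must be bilinear on \<open>V_dG\<close>. As the integral of a function that
is not integrable is zero by convention, this is a matter of integrability: each integrand is measurable and
essentially bounded on a finite measure space. Inside the elements this follows from the
regularity of the data. On the faces the delicate factor is the trace of the diffusion matrix: its pieces of
continuity are unrelated to the mesh, so its limit at a face point need not exist.
It is nevertheless a Borel function (\<open>borel_measurable_trace_from\<close>): for every function
the set of face points at which the limit exists is relatively \<open>G\<^sub>\<delta>\<close>, the limit is continuous there,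
and \<open>Lim\<close> takes one and the same default value at all other points.

The remaining geometric fact is that functions in \<open>V_cdG\<close> have no jump on the faces
of the continuous region (\<open>jump_V_cdG\<close>). On an interior face the two traces agree, so the
jump vanishes because the two outward normals are opposite (\<open>outward_normals_opposite\<close>).\<close>

section \<open>Penalty limits in a finite-dimensional space\<close>

definition linear_form_on :: "'v::real_vector set \<Rightarrow> ('v \<Rightarrow> 'b::real_vector) \<Rightarrow> bool"
  where "linear_form_on V f \<longleftrightarrow>
    (\<forall>u\<in>V. \<forall>v\<in>V. f (u + v) = f u + f v) \<and> (\<forall>a. \<forall>v\<in>V. f (a *\<^sub>R v) = a *\<^sub>R f v)"

definition bilinear_form_on :: "'v::real_vector set \<Rightarrow> ('v \<Rightarrow> 'v \<Rightarrow> real) \<Rightarrow> bool"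
  where "bilinear_form_on V \<beta> \<longleftrightarrow>
    (\<forall>u\<in>V. linear_form_on V (\<beta> u)) \<and> (\<forall>v\<in>V. linear_form_on V (\<lambda>u. \<beta> u v))"

definition seminorm_on :: "'v::real_vector set \<Rightarrow> ('v \<Rightarrow> real) \<Rightarrow> bool"
  where "seminorm_on V P \<longleftrightarrow>
    (\<forall>a. \<forall>v\<in>V. P (a *\<^sub>R v) = \<bar>a\<bar> * P v) \<and> (\<forall>u\<in>V. \<forall>v\<in>V. P (u + v) \<le> P u + P v)"

lemma seminorm_on_norm: "norm_on V N \<Longrightarrow> seminorm_on V N"
  by (simp add: norm_on_def seminorm_on_def)

lemma seminorm_on_abs_linear: "linear_form_on V f \<Longrightarrow> seminorm_on V (\<lambda>v. \<bar>f v :: real\<bar>)"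
  by (auto simp: linear_form_on_def seminorm_on_def abs_mult)

lemma seminorm_on_nonneg:
  assumes V: "subspace V" and P: "seminorm_on V P" and v: "v \<in> V"
  shows "0 \<le> P v"
proof -
  have "P (0 *\<^sub>R v) = \<bar>0\<bar> * P v" "P ((-1) *\<^sub>R v) = \<bar>-1\<bar> * P v"
    using P v unfolding seminorm_on_def by blast+
  moreover have "P (v + (-1) *\<^sub>R v) \<le> P v + P ((-1) *\<^sub>R v)"
    using P v subspace_scale[OF V v] unfolding seminorm_on_def by blast
  ultimately show ?thesis by simp
qed

lemma seminorm_on_sum_le:
  assumes V: "subspace V" and P: "seminorm_on V P" and B: "finite B" "B \<subseteq> V"
  shows "P (\<Sum>b\<in>B. c b *\<^sub>R b) \<le> (\<Sum>b\<in>B. \<bar>c b\<bar> * P b)"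
  using B
proof (induction B rule: finite_induct)
  case empty
  have "P (0 *\<^sub>R 0) = \<bar>0\<bar> * P 0"
    using P subspace_0[OF V] unfolding seminorm_on_def by blast
  then show ?case by simp
next
  case (insert b B)
  have *: "c b *\<^sub>R b \<in> V" "(\<Sum>b\<in>B. c b *\<^sub>R b) \<in> V"
    using insert.prems by (auto intro!: subspace_scale[OF V] subspace_sum[OF V])
  have "P (c b *\<^sub>R b + (\<Sum>b\<in>B. c b *\<^sub>R b)) \<le> P (c b *\<^sub>R b) + P (\<Sum>b\<in>B. c b *\<^sub>R b)"
    using P * unfolding seminorm_on_def by blast
  moreover have "P (c b *\<^sub>R b) = \<bar>c b\<bar> * P b"
    using P insert.prems unfolding seminorm_on_def by blast
  ultimately show ?case using insert by simp
qed

text \<open>The norm is a Lipschitz function of the coefficients, so it attains its minimum on the unit sphere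
of the coefficient space, which is compact in the product topology; independence makes that
minimum positive.\<close>

lemma norm_on_coefficient_bound:
  assumes V: "subspace V" and N: "norm_on V N"
    and B: "finite B" "B \<subseteq> V" "independent B"
  shows "\<exists>\<mu>>0. \<forall>c. \<mu> * (\<Sum>b\<in>B. \<bar>c b\<bar>) \<le> N (\<Sum>b\<in>B. c b *\<^sub>R b)"
proof (cases "B = {}")
  case True
  have "0 \<le> N 0"
    using N subspace_0[OF V] unfolding norm_on_def by blast
  then show ?thesis by (intro exI[of _ 1]) (simp add: True)
next
  case False
  \<comment> \<open>The synthesis map from coefficients to vectors; coefficients outside \<open>B\<close> are ignored.\<close>
  define T where "T c = (\<Sum>b\<in>B. c b *\<^sub>R b)" for c :: "'a \<Rightarrow> real"
  have TV: "T c \<in> V" for c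
    unfolding T_def using B by (auto intro!: subspace_scale[OF V] subspace_sum[OF V])
  have Nsemi: "seminorm_on V N" using N by (rule seminorm_on_norm)
  have lip: "\<bar>N (T c) - N (T d)\<bar> \<le> (\<Sum>b\<in>B. \<bar>c b - d b\<bar> * N b)" for c d
  proof -
    have le: "N (T c) \<le> N (T d) + (\<Sum>b\<in>B. \<bar>c b - d b\<bar> * N b)" for c d
    proof -
      have "T c = T d + T (\<lambda>b. c b - d b)"
        by (simp add: T_def algebra_simps sum_subtractf)
      then have "N (T c) \<le> N (T d) + N (T (\<lambda>b. c b - d b))"
        using Nsemi TV unfolding seminorm_on_def by metis
      also have "N (T (\<lambda>b. c b - d b)) \<le> (\<Sum>b\<in>B. \<bar>c b - d b\<bar> * N b)"
        unfolding T_def by (rule seminorm_on_sum_le[OF V Nsemi B(1,2)])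
      finally show ?thesis by simp
    qed
    have "(\<Sum>b\<in>B. \<bar>d b - c b\<bar> * N b) = (\<Sum>b\<in>B. \<bar>c b - d b\<bar> * N b)"
      by (simp add: abs_minus_commute)
    then show ?thesis using le[of c d] le[of d c] by linarith
  qed
  have cont: "continuous_on X (\<lambda>c. N (T c))" for X
  proof -
    have "((\<lambda>c. N (T c)) \<longlongrightarrow> N (T c0)) (at c0 within X)" for c0
    proof -
      have "((\<lambda>c. \<Sum>b\<in>B. \<bar>c b - c0 b\<bar> * N b) \<longlongrightarrow> (\<Sum>b\<in>B. \<bar>c0 b - c0 b\<bar> * N b)) (at c0 within X)"
        by (intro tendsto_intros continuous_on_product_coordinates[unfolded continuous_on_def, rule_format]
            tendsto_within_subset[OF continuous_on_product_coordinates[unfolded continuous_on_def, rule_format]])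
          auto
      then have "((\<lambda>c. \<Sum>b\<in>B. \<bar>c b - c0 b\<bar> * N b) \<longlongrightarrow> 0) (at c0 within X)" by simp
      then have "((\<lambda>c. N (T c) - N (T c0)) \<longlongrightarrow> 0) (at c0 within X)"
        by (rule Lim_null_comparison[rotated]) (simp add: lip)
      then show ?thesis by (simp add: LIM_zero_iff)
    qed
    then show ?thesis by (simp add: continuous_on_def)
  qed
  \<comment> \<open>Coefficients outside \<open>B\<close> are pinned to zero, which makes the box compact although the index
    type may be infinite.\<close>
  define Q where "Q = (PiE UNIV (\<lambda>b. if b \<in> B then {-1..1} else {0}) :: ('a \<Rightarrow> real) set)"
  define K where "K = Q \<inter> {c. (\<Sum>b\<in>B. \<bar>c b\<bar>) = 1}"
  have "compact Q"
    unfolding Q_def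
    using compactin_PiE[of "\<lambda>b::'a. euclidean::real topology" UNIV "\<lambda>b. if b \<in> B then {-1..1} else {0}"]
    by (simp add: euclidean_product_topology)
  moreover have "closed {c::'a \<Rightarrow> real. (\<Sum>b\<in>B. \<bar>c b\<bar>) = 1}"
    by (intro closed_Collect_eq continuous_intros continuous_on_product_coordinates)
  ultimately have K: "compact K" unfolding K_def by (rule compact_Int_closed)
  have ne: "K \<noteq> {}"
  proof -
    obtain b0 where "b0 \<in> B" using False by blast
    then have "(\<lambda>b. if b = b0 then 1 else 0) \<in> K"
      using B(1) by (auto simp: K_def Q_def if_distrib[of abs] cong: if_cong)
    then show ?thesis by blast
  qed
  obtain c0 where c0: "c0 \<in> K" and min: "\<And>c. c \<in> K \<Longrightarrow> N (T c0) \<le> N (T c)"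
    using continuous_attains_inf[OF K ne cont] by blast
  have "T c0 \<noteq> 0"
  proof
    assume "T c0 = 0"
    then have "\<forall>b\<in>B. c0 b = 0"
      using independentD[OF B(3,1) subset_refl] unfolding T_def by blast
    then show False using c0 by (simp add: K_def)
  qed
  then have pos: "0 < N (T c0)"
    using N TV[of c0] unfolding norm_on_def by (metis order_le_less)
  have "N (T c0) * (\<Sum>b\<in>B. \<bar>c b\<bar>) \<le> N (T c)" for c
  proof (cases "(\<Sum>b\<in>B. \<bar>c b\<bar>) = 0")
    case True
    then show ?thesis using N TV[of c] by (simp add: norm_on_def)
  next
    case nz: False
    define s where "s = (\<Sum>b\<in>B. \<bar>c b\<bar>)"
    have s: "s > 0" using nz unfolding s_def by (metis abs_ge_zero order_le_less sum_nonneg)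
    define d where "d b = (if b \<in> B then c b / s else 0)" for b
    have le: "\<bar>c b\<bar> \<le> s" if "b \<in> B" for b
      unfolding s_def using that B(1) by (intro member_le_sum) auto
    have "- s \<le> c b \<and> c b \<le> s" if "b \<in> B" for b
      using le[OF that] by linarith
    then have "d \<in> Q"
      using s by (auto simp: Q_def d_def field_simps)
    moreover have "(\<Sum>b\<in>B. \<bar>d b\<bar>) = 1"
      using s by (simp add: d_def sum_divide_distrib[symmetric] s_def[symmetric])
    ultimately have "N (T c0) \<le> N (T d)" by (intro min) (simp add: K_def)
    also have "T d = (1 / s) *\<^sub>R T c"
      by (simp add: T_def d_def scaleR_sum_right)
    also have "N ((1 / s) *\<^sub>R T c) = \<bar>1 / s\<bar> * N (T c)"
      using Nsemi TV[of c] unfolding seminorm_on_def by blast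
    finally show ?thesis using s by (simp add: s_def[symmetric] field_simps)
  qed
  then show ?thesis using pos unfolding T_def by blast
qed

text \<open>This single comparison provides both constants of the convergence proof: applied to the absolute
value of a linear form it says that the form is bounded, applied to a second norm it is the
equivalence of norms.\<close>

lemma seminorm_le_norm_finite_dim:
  assumes V: "subspace V" and G: "finite G" "V \<subseteq> span G"
    and N: "norm_on V N" and P: "seminorm_on V P"
  shows "\<exists>C\<ge>0. \<forall>v\<in>V. P v \<le> C * N v"
proof -
  obtain B where B: "B \<subseteq> V" "independent B" "V \<subseteq> span B"
    by (rule maximal_independent_subset) 
  have fin: "finite B"
    using independent_span_bound[OF G(1) B(2)] B(1) G(2) by auto
  obtain \<mu> where \<mu>: "\<mu> > 0" "\<And>c. \<mu> * (\<Sum>b\<in>B. \<bar>c b\<bar>) \<le> N (\<Sum>b\<in>B. c b *\<^sub>R b)"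
    using norm_on_coefficient_bound[OF V N fin B(1,2)] by blast
  define p where "p = (\<Sum>b\<in>B. P b)"
  have Pb: "0 \<le> P b" if "b \<in> B" for b
    using seminorm_on_nonneg[OF V P] that B(1) by blast
  then have p: "0 \<le> p" unfolding p_def by (rule sum_nonneg)
  have "P v \<le> p / \<mu> * N v" if v: "v \<in> V" for v
  proof -
    obtain c where c: "v = (\<Sum>b\<in>B. c b *\<^sub>R b)"
      using v B(3) span_finite[OF fin] by auto
    have "P v \<le> (\<Sum>b\<in>B. \<bar>c b\<bar> * P b)"
      unfolding c by (rule seminorm_on_sum_le[OF V P fin B(1)])
    also have "\<dots> \<le> (\<Sum>b\<in>B. \<bar>c b\<bar> * p)"
      unfolding p_def using Pb fin by (intro sum_mono mult_left_mono member_le_sum) auto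
    also have "\<dots> = p * (\<Sum>b\<in>B. \<bar>c b\<bar>)" by (simp add: sum_distrib_left mult.commute)
    also have "\<dots> \<le> p * (N v / \<mu>)"
      using \<mu>(2)[of c] \<mu>(1) p by (intro mult_left_mono) (simp_all add: c field_simps)
    finally show ?thesis by simp
  qed
  then show ?thesis using p \<mu>(1) by (intro exI[of _ "p / \<mu>"]) auto
qed

text \<open>The parts played here by \<open>U\<close>, \<open>W\<close>, \<open>E\<close> and \<open>s\<close> are those of the conforming space, its complement, the
energy norm and the penalty seminorm. The proof bounds the energy norm of the error by a
multiple of \<open>\<sigma>\<close> to the power \<open>-1/2\<close>.\<close>

theorem penalty_limit:
  fixes V :: "'v::real_vector set" and w :: "real \<Rightarrow> 'v"
  assumes V: "subspace V" "finite G" "V \<subseteq> span G"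
    and W: "subspace W" "direct_sum V U W"
    and \<beta>: "bilinear_form_on V \<beta>" and S: "bilinear_form_on V S" and l: "linear_form_on V l"
    and S_U: "\<And>u v. u \<in> U \<Longrightarrow> v \<in> V \<Longrightarrow> S u v = 0" "\<And>u v. u \<in> U \<Longrightarrow> v \<in> V \<Longrightarrow> S v u = 0"
    and S_sq: "\<And>v. v \<in> V \<Longrightarrow> S v v = (s v)\<^sup>2"
    and norms: "norm_on V E" "norm_on W s" "norm_on V N"
    and coercive: "\<Lambda> > 0" "\<And>v. v \<in> V \<Longrightarrow> \<Lambda> * (E v)\<^sup>2 \<le> \<beta> v v"
    and w: "\<And>\<sigma>. \<sigma> \<ge> 0 \<Longrightarrow> w \<sigma> \<in> V"
      "\<And>\<sigma> v. \<sigma> \<ge> 0 \<Longrightarrow> v \<in> V \<Longrightarrow> \<beta> (w \<sigma>) v + \<sigma> * S (w \<sigma>) v = l v"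
    and z: "z \<in> U" "\<And>v. v \<in> U \<Longrightarrow> \<beta> z v = l v"
  shows "((\<lambda>\<sigma>. N (w \<sigma> - z)) \<longlongrightarrow> 0) at_top"
proof -
  have U0: "0 \<in> U" and UV: "U \<subseteq> V" and WV: "W \<subseteq> V"
  proof -
    show "0 \<in> U" using W(2) unfolding direct_sum_def by blast
    have "u + 0 \<in> V" if "u \<in> U" for u
      using W(2) subspace_0[OF W(1)] that unfolding direct_sum_def by blast
    then show "U \<subseteq> V" by auto
    have "0 + p \<in> V" if "p \<in> W" for p
      using W(2) \<open>0 \<in> U\<close> that unfolding direct_sum_def by blast
    then show "W \<subseteq> V" by auto
  qed
  \<comment> \<open>The residual of \<open>z\<close>.\<close>
  define F where "F v = l v - \<beta> z v" for v
  have lin_z: "linear_form_on V (\<beta> z)" using \<beta> z(1) UV unfolding bilinear_form_on_def by blast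
  have F: "linear_form_on V F"
    using l lin_z unfolding F_def linear_form_on_def by (auto simp: algebra_simps)
  have F_U: "F u = 0" if "u \<in> U" for u using z(2)[OF that] by (simp add: F_def)
  have "linear_form_on W F" using F WV unfolding linear_form_on_def by blast
  then obtain C where C: "\<And>p. p \<in> W \<Longrightarrow> \<bar>F p\<bar> \<le> C * s p"
    using seminorm_le_norm_finite_dim[OF W(1) V(2) _ norms(2) seminorm_on_abs_linear] WV V(3)
    by (metis order_trans)
  obtain K where K: "0 \<le> K" "\<And>v. v \<in> V \<Longrightarrow> N v \<le> K * E v"
    using seminorm_le_norm_finite_dim[OF V norms(1) seminorm_on_norm[OF norms(3)]] by blast
  have bound: "0 \<le> N (w \<sigma> - z) \<and> N (w \<sigma> - z) \<le> K * sqrt (C\<^sup>2 / (4 * \<Lambda> * \<sigma>))" if \<sigma>: "\<sigma> > 0" for \<sigma>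
  proof -
    define e where "e = w \<sigma> - z"
    have eV: "e \<in> V" unfolding e_def using w(1)[of \<sigma>] \<sigma> z(1) UV by (auto intro: subspace_diff[OF V(1)])
    then obtain u p where up: "e = u + p" "u \<in> U" "p \<in> W"
      using W(2) unfolding direct_sum_def by blast
    have zV: "z \<in> V" and uV: "u \<in> V" and pV: "p \<in> V" using z(1) up UV WV by auto
    have split: "\<gamma> (w \<sigma>) e = \<gamma> e e + \<gamma> z e" if "bilinear_form_on V \<gamma>" for \<gamma>
    proof -
      have "\<gamma> (e + z) e = \<gamma> e e + \<gamma> z e"
        using that eV zV unfolding bilinear_form_on_def linear_form_on_def by blast
      then show ?thesis by (simp add: e_def)
    qed
    have "F (u + p) = F u + F p" using F uV pV unfolding linear_form_on_def by blast
    then have Fe: "F e = F p" using F_U[OF up(2)] up(1) by simp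
    have "S (u + p) (u + p) = S u (u + p) + S p (u + p)"
      using S uV pV subspace_add[OF V(1) uV pV] unfolding bilinear_form_on_def linear_form_on_def by blast
    moreover have "S p (u + p) = S p u + S p p"
      using S uV pV unfolding bilinear_form_on_def linear_form_on_def by blast
    ultimately have See: "S e e = (s p)\<^sup>2"
      using S_U[OF up(2)] S_sq pV eV up(1) by simp
    have "\<beta> e e + \<sigma> * (s p)\<^sup>2 = F p"
      using w(2)[OF less_imp_le[OF \<sigma>] eV] split[OF \<beta>] split[OF S] S_U(1)[OF z(1) eV] Fe See
      by (simp add: F_def)
    also have "\<dots> \<le> C * s p" using C[OF up(3)] by linarith
    also have "\<dots> \<le> \<sigma> * (s p)\<^sup>2 + C\<^sup>2 / (4 * \<sigma>)"
    proof -
      \<comment> \<open>Young's inequality, weighted such that the quadratic term cancels against the penalty.\<close>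
      have "0 \<le> (2 * \<sigma> * s p - C)\<^sup>2 / (4 * \<sigma>)" using \<sigma> by simp
      also have "\<dots> = \<sigma> * (s p)\<^sup>2 + C\<^sup>2 / (4 * \<sigma>) - C * s p"
        using \<sigma> by (simp add: field_simps power2_eq_square)
      finally show ?thesis by simp
    qed
    finally have "\<Lambda> * (E e)\<^sup>2 \<le> C\<^sup>2 / (4 * \<sigma>)" using coercive(2)[OF eV] by linarith
    then have "(E e)\<^sup>2 \<le> C\<^sup>2 / (4 * \<Lambda> * \<sigma>)" using coercive(1) \<sigma> by (simp add: field_simps)
    then have "E e \<le> sqrt (C\<^sup>2 / (4 * \<Lambda> * \<sigma>))" by (rule real_le_rsqrt)
    then have "K * E e \<le> K * sqrt (C\<^sup>2 / (4 * \<Lambda> * \<sigma>))" using K(1) by (rule mult_left_mono)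
    moreover have "0 \<le> N e" using norms(3) eV unfolding norm_on_def by blast
    ultimately show ?thesis using K(2)[OF eV] by (simp add: e_def)
  qed
  have "((\<lambda>\<sigma>. C\<^sup>2 / (4 * \<Lambda> * \<sigma>)) \<longlongrightarrow> 0) at_top"
    using coercive(1)
    by (intro tendsto_divide_0[OF tendsto_const] filterlim_at_top_imp_at_infinity
        filterlim_tendsto_pos_mult_at_top[OF tendsto_const _ filterlim_ident]) auto
  from tendsto_mult[OF tendsto_const tendsto_real_sqrt[OF this], of K]
  have lim: "((\<lambda>\<sigma>. K * sqrt (C\<^sup>2 / (4 * \<Lambda> * \<sigma>))) \<longlongrightarrow> 0) at_top" by simp
  show ?thesis
    by (rule tendsto_sandwich[OF _ _ tendsto_const lim];
        rule eventually_mono[OF eventually_gt_at_top[of 0]]; use bound in blast)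
qed

section \<open>Integrals of bounded measurable integrands\<close>

text \<open>Membership in \<open>L\<^sup>\<infinity>\<close>, which is an algebra and, for a finite measure, contained in \<open>L\<^sup>1\<close>: integrability of
products can be checked factor by factor.\<close>

definition bounded_measurable :: "'a measure \<Rightarrow> ('a \<Rightarrow> 'b::euclidean_space) \<Rightarrow> bool"
  where "bounded_measurable M f \<longleftrightarrow> f \<in> borel_measurable M \<and> (\<exists>K. AE x in M. norm (f x) \<le> K)"

lemma bounded_measurableI:
  assumes "f \<in> borel_measurable M" "\<And>x. x \<in> space M \<Longrightarrow> norm (f x) \<le> K"
  shows "bounded_measurable M f"
  using assms unfolding bounded_measurable_def by blast

lemma bounded_measurable_integrable:
  fixes f :: "'a \<Rightarrow> real"
  assumes "finite_measure M" "bounded_measurable M f"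
  shows "integrable M f"
  using assms finite_measure.integrable_const_bound unfolding bounded_measurable_def by blast

lemma bounded_measurable_const: "bounded_measurable M (\<lambda>x. c)"
  by (rule bounded_measurableI[where K = "norm c"]) auto

lemma bounded_measurable_bilinear:
  assumes h: "bounded_bilinear h" and f: "bounded_measurable M f" and g: "bounded_measurable M g"
  shows "bounded_measurable M (\<lambda>x. h (f x) (g x))"
proof -
  obtain K L where K: "AE x in M. norm (f x) \<le> K" and L: "AE x in M. norm (g x) \<le> L"
    using f g unfolding bounded_measurable_def by blast
  obtain C where C: "0 \<le> C" "\<And>a b. norm (h a b) \<le> norm a * norm b * C"
    using bounded_bilinear.nonneg_bounded[OF h] by blast
  have "AE x in M. norm (h (f x) (g x)) \<le> K * L * C"
    using K L
  proof eventually_elim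
    case (elim x)
    have "norm (f x) * norm (g x) \<le> K * L"
      using elim by (intro mult_mono order_trans[OF norm_ge_zero elim(1)]) auto
    then show ?case using C(2)[of "f x" "g x"] C(1) by (meson mult_right_mono order_trans)
  qed
  moreover have "continuous_on UNIV (\<lambda>x. h (fst x) (snd x))"
    by (rule bounded_bilinear.continuous_on[OF h continuous_on_fst[OF continuous_on_id]
          continuous_on_snd[OF continuous_on_id]])
  then have "(\<lambda>x. h (f x) (g x)) \<in> borel_measurable M"
    using f g unfolding bounded_measurable_def by (blast intro: borel_measurable_continuous_Pair)
  ultimately show ?thesis unfolding bounded_measurable_def by blast
qed

lemma bounded_measurable_add:
  assumes f: "bounded_measurable M f" and g: "bounded_measurable M g"
  shows "bounded_measurable M (\<lambda>x. f x + g x)"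
proof -
  obtain K L where K: "AE x in M. norm (f x) \<le> K" and L: "AE x in M. norm (g x) \<le> L"
    using f g unfolding bounded_measurable_def by blast
  have "AE x in M. norm (f x + g x) \<le> K + L"
    using K L by eventually_elim (meson add_mono norm_triangle_ineq order_trans)
  then show ?thesis using f g unfolding bounded_measurable_def by (auto intro: borel_measurable_add)
qed

lemmas bounded_measurable_mult = bounded_measurable_bilinear[OF bounded_bilinear_mult]
  and bounded_measurable_scaleR = bounded_measurable_bilinear[OF bounded_bilinear_scaleR]
  and bounded_measurable_inner = bounded_measurable_bilinear[OF bounded_bilinear_inner]

lemma bounded_measurable_diff:
  assumes f: "bounded_measurable M f" and g: "bounded_measurable M g"
  shows "bounded_measurable M (\<lambda>x. f x - g x)"
  using bounded_measurable_add[OF f bounded_measurable_scaleR[OF bounded_measurable_const[of M "-1::real"] g]]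
  by simp

lemma bounded_measurable_sum:
  assumes "\<And>i. i \<in> I \<Longrightarrow> bounded_measurable M (f i)"
  shows "bounded_measurable M (\<lambda>x. \<Sum>i\<in>I. f i x)"
  using assms
proof (induction I rule: infinite_finite_induct)
  case (insert i I)
  then show ?case by (auto intro: bounded_measurable_add)
qed (simp_all add: bounded_measurable_const)

lemma bounded_measurable_if:
  assumes f: "bounded_measurable M f" and P: "{x \<in> space M. P x} \<in> sets M"
  shows "bounded_measurable M (\<lambda>x. if P x then f x else 0)"
proof -
  obtain K where K: "AE x in M. norm (f x) \<le> K"
    using f unfolding bounded_measurable_def by blast
  then have "AE x in M. norm (if P x then f x else 0) \<le> K"
    by eventually_elim (auto intro: order_trans[OF norm_ge_zero])
  moreover have "(\<lambda>x. if P x then f x else 0) \<in> borel_measurable M"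
    using f P unfolding bounded_measurable_def by (intro measurable_If) auto
  ultimately show ?thesis unfolding bounded_measurable_def by blast
qed

lemma bounded_bilinear_matrix_vector_mult:
  "bounded_bilinear ((*v) :: real^'n^'m \<Rightarrow> real^'n \<Rightarrow> real^'m)"
  by (rule bilinear_conv_bounded_bilinear[THEN iffD1])
    (auto simp: bilinear_def linear_iff matrix_vector_mult_add_rdistrib matrix_vector_right_distrib
      matrix_vector_mult_scaleR scaleR_matrix_vector_assoc)

lemmas bounded_measurable_matrix_vector =
  bounded_measurable_bilinear[OF bounded_bilinear_matrix_vector_mult]

section \<open>Integrals depending linearly on their integrand\<close>

lemma linear_form_on_compose:
  assumes "linear h" "linear_form_on V f"
  shows "linear_form_on V (\<lambda>v. h (f v))"
  using assms by (simp add: linear_form_on_def linear_add linear_scale)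

lemma linear_form_on_sum:
  assumes "\<And>i. i \<in> I \<Longrightarrow> linear_form_on V (f i)"
  shows "linear_form_on V (\<lambda>v. \<Sum>i\<in>I. f i v)"
  using assms by (auto simp: linear_form_on_def sum.distrib scaleR_sum_right intro!: sum.cong)

lemma linear_form_on_integral:
  assumes "\<And>v. v \<in> V \<Longrightarrow> integrable M (f v)"
    and "\<And>x. x \<in> space M \<Longrightarrow> linear_form_on V (\<lambda>v. f v x)"
    and V: "subspace V"
  shows "linear_form_on V (\<lambda>v. integral\<^sup>L M (f v) :: real)"
proof -
  have "integral\<^sup>L M (f (u + v)) = integral\<^sup>L M (f u) + integral\<^sup>L M (f v)"
    if "u \<in> V" "v \<in> V" for u v
  proof -
    have "integral\<^sup>L M (f (u + v)) = integral\<^sup>L M (\<lambda>x. f u x + f v x)"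
      using assms(2) that unfolding linear_form_on_def by (intro Bochner_Integration.integral_cong) auto
    then show ?thesis using assms(1) that by simp
  qed
  moreover have "integral\<^sup>L M (f (a *\<^sub>R v)) = a *\<^sub>R integral\<^sup>L M (f v)" if "v \<in> V" for a v
  proof -
    have "integral\<^sup>L M (f (a *\<^sub>R v)) = integral\<^sup>L M (\<lambda>x. a *\<^sub>R f v x)"
      using assms(2) that unfolding linear_form_on_def by (intro Bochner_Integration.integral_cong) auto
    then show ?thesis by simp
  qed
  ultimately show ?thesis unfolding linear_form_on_def by blast
qed

lemma bilinear_form_on_product:
  assumes h: "bounded_bilinear h" and "linear_form_on V f" "linear_form_on V g"
  shows "bilinear_form_on V (\<lambda>u v. h (f u) (g v))"
  using assms(2,3)
  by (simp add: bilinear_form_on_def linear_form_on_def bounded_bilinear.add_left[OF h]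
      bounded_bilinear.add_right[OF h] bounded_bilinear.scaleR_left[OF h] bounded_bilinear.scaleR_right[OF h])

lemmas bilinear_form_on_inner = bilinear_form_on_product[OF bounded_bilinear_inner]
  and bilinear_form_on_mult = bilinear_form_on_product[OF bounded_bilinear_mult]

lemma bilinear_form_on_swap: "bilinear_form_on V \<beta> \<Longrightarrow> bilinear_form_on V (\<lambda>u v. \<beta> v u)"
  by (simp add: bilinear_form_on_def)

lemma bilinear_form_on_add:
  "bilinear_form_on V \<beta> \<Longrightarrow> bilinear_form_on V \<gamma> \<Longrightarrow> bilinear_form_on V (\<lambda>u v. \<beta> u v + \<gamma> u v)"
  by (simp add: bilinear_form_on_def linear_form_on_def algebra_simps)

lemma bilinear_form_on_diff:
  "bilinear_form_on V \<beta> \<Longrightarrow> bilinear_form_on V \<gamma> \<Longrightarrow> bilinear_form_on V (\<lambda>u v. \<beta> u v - \<gamma> u v)"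
  by (simp add: bilinear_form_on_def linear_form_on_def algebra_simps)

lemma bilinear_form_on_cmult:
  "bilinear_form_on V \<beta> \<Longrightarrow> bilinear_form_on V (\<lambda>u v. c * \<beta> u v)"
  by (simp add: bilinear_form_on_def linear_form_on_def algebra_simps)

lemma bilinear_form_on_sum:
  assumes "\<And>i. i \<in> I \<Longrightarrow> bilinear_form_on V (\<beta> i)"
  shows "bilinear_form_on V (\<lambda>u v. \<Sum>i\<in>I. \<beta> i u v)"
  using assms unfolding bilinear_form_on_def by (auto intro: linear_form_on_sum)

text \<open>Boundedness of the integrand is what makes the Bochner integral additive; bilinearity of the
integrand at each point alone would not suffice.\<close>

lemma bilinear_form_on_integral:
  assumes V: "subspace V" and M: "finite_measure M"
    and f: "\<And>u v. u \<in> V \<Longrightarrow> v \<in> V \<Longrightarrow> bounded_measurable M (f u v)"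
    and lin: "\<And>x. x \<in> space M \<Longrightarrow> bilinear_form_on V (\<lambda>u v. f u v x)"
  shows "bilinear_form_on V (\<lambda>u v. integral\<^sup>L M (f u v))"
  using lin bounded_measurable_integrable[OF M f] unfolding bilinear_form_on_def
  by (auto intro!: linear_form_on_integral[OF _ _ V])

section \<open>Traces of arbitrary functions\<close>

text \<open>Where there is no limit, the description operator is applied to the predicate that is constantly
false; hence the value depends neither on the function nor on the point.\<close>

lemma Lim_undefined:
  fixes g :: "'a::t2_space \<Rightarrow> 'b::t2_space"
  assumes "\<nexists>l. (g \<longlongrightarrow> l) F"
  shows "Lim F g = (THE l. False)"
  using assms by (simp add: t2_space_class.Lim_def)

text \<open>Cauchy's criterion. Restricting to countably many tolerances exhibits the set of convergence as a
countable intersection, whose members are open by \<open>open_small_oscillation\<close>.\<close>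

lemma limit_exists_iff_small_oscillation:
  fixes g :: "'a::metric_space \<Rightarrow> 'b::complete_space"
  assumes x: "x \<in> closure E" "x \<notin> E"
  shows "(\<exists>l. (g \<longlongrightarrow> l) (at x within E)) \<longleftrightarrow>
    (\<forall>n::nat. \<exists>\<delta>>0. \<forall>y\<in>E \<inter> ball x \<delta>. \<forall>z\<in>E \<inter> ball x \<delta>. dist (g y) (g z) < 1 / Suc n)"
    (is "?L \<longleftrightarrow> ?R")
proof
  assume ?L
  then obtain l where l: "(g \<longlongrightarrow> l) (at x within E)" ..
  show ?R
  proof
    fix n
    obtain \<delta> where \<delta>: "\<delta> > 0" "\<And>y. y \<in> E \<Longrightarrow> 0 < dist y x \<and> dist y x < \<delta> \<Longrightarrow> dist (g y) l < 1 / Suc n / 2"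
      using l unfolding Lim_within by (metis half_gt_zero divide_pos_pos zero_less_one of_nat_0_less_iff zero_less_Suc)
    have "dist (g y) (g z) < 1 / Suc n" if "y \<in> E \<inter> ball x \<delta>" "z \<in> E \<inter> ball x \<delta>" for y z
    proof -
      have "y \<noteq> x" "z \<noteq> x" using that x(2) by auto
      then have "dist (g y) l < 1 / Suc n / 2" "dist (g z) l < 1 / Suc n / 2"
        using \<delta>(2)[of y] \<delta>(2)[of z] that by (simp_all add: dist_commute)
      then show ?thesis by (rule dist_triangle_half_l)
    qed
    then show "\<exists>\<delta>>0. \<forall>y\<in>E \<inter> ball x \<delta>. \<forall>z\<in>E \<inter> ball x \<delta>. dist (g y) (g z) < 1 / Suc n"
      using \<delta>(1) by blast
  qed
next
  assume R: ?R
  have small: "\<exists>\<delta>>0. \<forall>y\<in>E \<inter> ball x \<delta>. \<forall>z\<in>E \<inter> ball x \<delta>. dist (g y) (g z) < \<epsilon>" if \<epsilon>: "\<epsilon> > 0" for \<epsilon>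
  proof -
    obtain n where "1 / Suc n < \<epsilon>" using nat_approx_posE[OF \<epsilon>] by blast
    then show ?thesis using R by (meson less_trans)
  qed
  obtain s where s: "\<And>n. s n \<in> E" "s \<longlonglongrightarrow> x" using x(1) unfolding closure_sequential by blast
  have "Cauchy (\<lambda>n. g (s n))"
  proof (rule metric_CauchyI)
    fix \<epsilon> :: real assume "\<epsilon> > 0"
    then obtain \<delta> where \<delta>: "\<delta> > 0" "\<forall>y\<in>E \<inter> ball x \<delta>. \<forall>z\<in>E \<inter> ball x \<delta>. dist (g y) (g z) < \<epsilon>"
      using small by blast
    obtain M where "\<forall>n\<ge>M. dist (s n) x < \<delta>"
      using s(2) \<delta>(1) unfolding lim_sequentially by blast
    then show "\<exists>M. \<forall>m\<ge>M. \<forall>n\<ge>M. dist (g (s m)) (g (s n)) < \<epsilon>"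
      using \<delta>(2) s(1) by (auto simp: dist_commute intro!: exI[of _ M])
  qed
  then obtain l where l: "(\<lambda>n. g (s n)) \<longlonglongrightarrow> l" using Cauchy_convergent convergent_def by blast
  have "(g \<longlongrightarrow> l) (at x within E)"
    unfolding Lim_within
  proof (intro allI impI)
    fix \<epsilon> :: real assume \<epsilon>: "\<epsilon> > 0"
    then obtain \<delta> where \<delta>: "\<delta> > 0" "\<forall>y\<in>E \<inter> ball x \<delta>. \<forall>z\<in>E \<inter> ball x \<delta>. dist (g y) (g z) < \<epsilon> / 2"
      using small[of "\<epsilon> / 2"] by auto
    obtain M1 where M1: "\<forall>n\<ge>M1. dist (s n) x < \<delta>"
      using s(2) \<delta>(1) unfolding lim_sequentially by blast
    obtain M2 where M2: "\<forall>n\<ge>M2. dist (g (s n)) l < \<epsilon> / 2"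
      using l \<epsilon> unfolding lim_sequentially by (meson half_gt_zero)
    define z where "z = s (max M1 M2)"
    have z: "z \<in> E \<inter> ball x \<delta>" "dist (g z) l < \<epsilon> / 2"
      using M1 M2 s(1) by (auto simp: z_def dist_commute)
    have "dist (g y) l < \<epsilon>" if "y \<in> E" "dist y x < \<delta>" for y
    proof -
      have "y \<in> E \<inter> ball x \<delta>" using that by (simp add: dist_commute)
      then have "dist (g z) (g y) < \<epsilon> / 2" using \<delta>(2) z(1) by blast
      then show ?thesis using z(2) by (rule dist_triangle_half_r)
    qed
    then show "\<exists>d>0. \<forall>y\<in>E. 0 < dist y x \<and> dist y x < d \<longrightarrow> dist (g y) l < \<epsilon>"
      using \<delta>(1) by blast
  qed
  then show ?L ..
qed

lemma open_small_oscillation: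
  fixes g :: "'a::metric_space \<Rightarrow> 'b::metric_space"
  shows "open {x. \<exists>\<delta>>0. \<forall>y\<in>E \<inter> ball x \<delta>. \<forall>z\<in>E \<inter> ball x \<delta>. dist (g y) (g z) < \<epsilon>}" (is "open ?S")
  unfolding open_contains_ball
proof
  fix x assume "x \<in> ?S"
  then obtain \<delta> where \<delta>: "\<delta> > 0" "\<forall>y\<in>E \<inter> ball x \<delta>. \<forall>z\<in>E \<inter> ball x \<delta>. dist (g y) (g z) < \<epsilon>" by blast
  have "x' \<in> ?S" if "x' \<in> ball x (\<delta> / 2)" for x'
  proof -
    have "ball x' (\<delta> / 2) \<subseteq> ball x \<delta>"
    proof
      fix y assume "y \<in> ball x' (\<delta> / 2)"
      then show "y \<in> ball x \<delta>" using that dist_triangle[of x y x'] by simp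
    qed
    then show ?thesis using \<delta> by (auto intro!: exI[of _ "\<delta> / 2"])
  qed
  then show "\<exists>e>0. ball x e \<subseteq> ?S" using \<delta>(1) by (intro exI[of _ "\<delta> / 2"]) auto
qed

lemma trace_from_eq:
  assumes "(g \<longlongrightarrow> l) (at x within E)" "x \<in> closure E" "x \<notin> E"
  shows "trace_from E g x = l"
  unfolding trace_from_def
  using assms by (intro tendsto_Lim) (auto simp: at_within_eq_bot_iff)

text \<open>The extension of a function by its limits is continuous even if the function itself is not: near
\<open>x\<close>, each of its values is a limit of values of \<open>g\<close> that are close to the limit at \<open>x\<close>.\<close>

lemma continuous_on_trace_from:
  fixes g :: "real^'n \<Rightarrow> 'b::metric_space"
  assumes C: "\<And>x. x \<in> C \<Longrightarrow> x \<in> closure E \<and> x \<notin> E \<and> (\<exists>l. (g \<longlongrightarrow> l) (at x within E))"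
  shows "continuous_on C (trace_from E g)"
  unfolding continuous_on_iff
proof (intro ballI allI impI)
  have lim: "(g \<longlongrightarrow> trace_from E g x) (at x within E)" if "x \<in> C" for x
    using C[OF that] trace_from_eq by metis
  fix x and \<epsilon> :: real assume x: "x \<in> C" and \<epsilon>: "\<epsilon> > 0"
  have "\<epsilon> / 2 > 0" using \<epsilon> by simp
  then obtain \<delta> where \<delta>: "\<delta> > 0"
    "\<And>y. y \<in> E \<Longrightarrow> 0 < dist y x \<and> dist y x < \<delta> \<Longrightarrow> dist (g y) (trace_from E g x) < \<epsilon> / 2"
    using lim[OF x] unfolding Lim_within by blast
  have "dist (trace_from E g x') (trace_from E g x) < \<epsilon>" if x': "x' \<in> C" "dist x' x < \<delta>" for x'
  proof -
    have nb: "at x' within E \<noteq> bot" using C[OF x'(1)] by (auto simp: at_within_eq_bot_iff)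
    have "eventually (\<lambda>y. y \<in> ball x \<delta>) (at x' within E)"
      using x'(2) by (intro eventually_at_topological[THEN iffD2] exI[of _ "ball x \<delta>"]) (auto simp: dist_commute)
    moreover have "eventually (\<lambda>y. y \<in> E) (at x' within E)" by (simp add: eventually_at_filter)
    ultimately have "eventually (\<lambda>y. dist (trace_from E g x) (g y) \<le> \<epsilon> / 2) (at x' within E)"
    proof eventually_elim
      case (elim y)
      then have "y \<noteq> x" using C[OF x] by auto
      then show ?case using \<delta>(2)[of y] elim by (auto simp: dist_commute)
    qed
    then have "dist (trace_from E g x) (trace_from E g x') \<le> \<epsilon> / 2"
      using Lim_dist_ubound[OF nb lim[OF x'(1)]] by blast
    then show ?thesis using \<epsilon> by (simp add: dist_commute)
  qed
  then show "\<exists>d>0. \<forall>x'\<in>C. dist x' x < d \<longrightarrow> dist (trace_from E g x') (trace_from E g x) < \<epsilon>"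
    using \<delta>(1) by blast
qed

text \<open>The set \<open>F\<close> splits into the set of convergence, which is a countable
intersection of open sets and carries a continuous trace, and the rest, where the trace is constant.\<close>

lemma borel_measurable_trace_from:
  fixes g :: "real^'n \<Rightarrow> 'b::{complete_space, second_countable_topology}"
  assumes F: "F \<in> sets borel" "F \<subseteq> closure E" "E \<inter> F = {}"
  shows "trace_from E g \<in> borel_measurable (restrict_space borel F)"
proof -
  define W where "W n = {x. \<exists>\<delta>>0. \<forall>y\<in>E \<inter> ball x \<delta>. \<forall>z\<in>E \<inter> ball x \<delta>. dist (g y) (g z) < 1 / Suc n}" for n :: nat
  define C where "C = F \<inter> (\<Inter>n. W n)"
  have C_iff: "x \<in> C \<longleftrightarrow> (\<exists>l. (g \<longlongrightarrow> l) (at x within E))" if "x \<in> F" for x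
    using limit_exists_iff_small_oscillation[of x E g] that F(2,3) unfolding C_def W_def by blast
  have C: "C \<in> sets borel"
    unfolding C_def W_def using F(1)
    by (intro sets.Int sets.countable_INT) (auto intro!: borel_open open_small_oscillation)
  show ?thesis
  proof (rule measurable_piecewise_restrict[where C = "{C, F - C}"])
    fix \<Omega> assume "\<Omega> \<in> {C, F - C}"
    then consider "\<Omega> = C" | "\<Omega> = F - C" by blast
    then show "trace_from E g \<in> borel_measurable (restrict_space (restrict_space borel F) \<Omega>)"
    proof cases
      case 1
      have "continuous_on C (trace_from E g)"
        using C_iff F(2,3) by (intro continuous_on_trace_from) (auto simp: C_def)
      moreover have "F \<inter> C = C" by (auto simp: C_def)
      ultimately show ?thesis
        using 1 by (simp add: restrict_restrict_space F(1) C borel_measurable_continuous_on_restrict)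
    next
      case 2
      have "trace_from E g x = (THE l. False)" if "x \<in> F - C" for x
        unfolding trace_from_def using C_iff that by (intro Lim_undefined) auto
      then have "trace_from E g \<in> borel_measurable (restrict_space (restrict_space borel F) \<Omega>) \<longleftrightarrow>
          (\<lambda>x. (THE l. False) :: 'b) \<in> borel_measurable (restrict_space (restrict_space borel F) \<Omega>)"
        using 2 by (intro measurable_cong) (auto simp: space_restrict_space)
      then show ?thesis by simp
    qed
  qed (use C F(1) in \<open>auto simp: C_def sets_restrict_space space_restrict_space\<close>)
qed

text \<open>The maximum accounts for the default value at points without a limit.\<close>

lemma norm_trace_from_le:
  fixes g :: "real^'n \<Rightarrow> 'b::real_normed_vector"
  assumes x: "x \<in> closure E" "x \<notin> E" and g: "\<And>y. y \<in> E \<Longrightarrow> norm (g y) \<le> K"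
  shows "norm (trace_from E g x) \<le> max K (norm (THE l::'b. False))"
proof (cases "\<exists>l. (g \<longlongrightarrow> l) (at x within E)")
  case True
  then obtain l where l: "(g \<longlongrightarrow> l) (at x within E)" ..
  have "norm l \<le> K"
    using x g by (intro Lim_norm_ubound[OF _ l]) (auto simp: at_within_eq_bot_iff eventually_at_filter)
  then show ?thesis using trace_from_eq[OF l x] by simp
next
  case False
  then show ?thesis unfolding trace_from_def by (simp add: Lim_undefined)
qed

section \<open>Simplices, faces and normals\<close>

lemma open_simplex_props:
  fixes E :: "(real^'n::finite) set"
  assumes "open_simplex E"
  shows "open E" "E \<noteq> {}" "convex E" "bounded E" "compact (closure E)"
proof -
  obtain K where K: "int CARD('n) simplex K" "E = interior K"
    using assms unfolding open_simplex_def by blast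
  have conv: "convex K" and comp: "compact K"
    using K(1) by (rule convex_simplex, rule compact_simplex)
  have "affine hull K = UNIV"
    using aff_dim_simplex[OF K(1)] aff_dim_eq_full[of K] by simp
  moreover from this have "K \<noteq> {}" by auto
  ultimately show "E \<noteq> {}"
    using rel_interior_interior rel_interior_eq_empty[OF conv] K(2) by metis
  show "open E" "convex E" using K(2) conv by (simp_all add: convex_interior)
  show bd: "bounded E"
    using K(2) comp by (metis bounded_subset compact_imp_bounded interior_subset)
  show "compact (closure E)" using bd by simp
qed

lemma interior_facesE:
  assumes "e \<in> interior_faces (D :: ('n::finite) cdg)"
  obtains E1 E2 where "fst e = {E1, E2}" "snd e = closure E1 \<inter> closure E2" "E1 \<in> T_h D" "E2 \<in> T_h D"
    "E1 \<noteq> E2" "aff_dim (closure E1 \<inter> closure E2) = int CARD('n) - 1"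
proof -
  obtain E1 E2 where "e = ({E1, E2}, closure E1 \<inter> closure E2)" "E1 \<in> T_h D" "E2 \<in> T_h D"
    "E1 \<noteq> E2" "aff_dim (closure E1 \<inter> closure E2) = int CARD('n) - 1"
    using assms unfolding interior_faces_def by blast
  then show ?thesis using that[of E1 E2] by simp
qed

lemma boundary_facesE:
  assumes "e \<in> boundary_faces D"
  obtains E where "fst e = {E}" "E \<in> T_h D" "snd e facet_of closure E" "snd e \<subseteq> frontier (Omega D)"
proof -
  obtain E F where "e = ({E}, F)" "E \<in> T_h D" "F facet_of closure E" "F \<subseteq> frontier (Omega D)"
    using assms unfolding boundary_faces_def by blast
  then show ?thesis using that[of E] by simp
qed

text \<open>Elements are disjoint from their faces: an element is open and disjoint from its neighbour, hence from the
closure of the neighbour; and it is contained in the open domain, hence disjoint from the boundary. So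
traces are limits at points outside the element.\<close>

lemma face_props:
  assumes mesh: "subdivision (Omega D) (T_h D)" and dom: "open (Omega D)" and e: "e \<in> faces D"
  shows "finite (fst e)" "fst e \<subseteq> T_h D" "compact (snd e)" "snd e \<noteq> {}"
    "\<And>E. E \<in> fst e \<Longrightarrow> snd e \<subseteq> closure E" "\<And>E. E \<in> fst e \<Longrightarrow> E \<inter> snd e = {}"
proof -
  have simp: "open_simplex E" if "E \<in> T_h D" for E using mesh that unfolding subdivision_def by blast
  have "e \<in> interior_faces D \<or> e \<in> boundary_faces D" using e unfolding faces_def by blast
  then have "finite (fst e) \<and> fst e \<subseteq> T_h D \<and> compact (snd e) \<and> snd e \<noteq> {} \<and>
      (\<forall>E\<in>fst e. snd e \<subseteq> closure E \<and> E \<inter> snd e = {})"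
  proof
    assume "e \<in> interior_faces D"
    then obtain E1 E2 where int: "fst e = {E1, E2}" "snd e = closure E1 \<inter> closure E2"
      "E1 \<in> T_h D" "E2 \<in> T_h D" "E1 \<noteq> E2" "aff_dim (closure E1 \<inter> closure E2) = int CARD('a) - 1"
      by (rule interior_facesE)
    have "E1 \<inter> E2 = {}"
      using mesh int unfolding subdivision_def pairwise_def disjnt_def by blast
    then have "E1 \<inter> closure E2 = {}" "E2 \<inter> closure E1 = {}"
      using open_Int_closure_eq_empty[of E1 E2] open_Int_closure_eq_empty[of E2 E1]
        open_simplex_props(1)[OF simp] int by auto
    moreover have "closure E1 \<inter> closure E2 \<noteq> {}" using int(6) by auto
    moreover have "compact (closure E1 \<inter> closure E2)"
      using open_simplex_props(5)[OF simp] int by (simp add: compact_Int)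
    ultimately show ?thesis using int by auto
  next
    assume "e \<in> boundary_faces D"
    then obtain E where bnd: "fst e = {E}" "E \<in> T_h D" "snd e facet_of closure E"
      "snd e \<subseteq> frontier (Omega D)"
      by (rule boundary_facesE)
    have "E \<subseteq> Omega D" using mesh bnd(2) unfolding subdivision_def by blast
    then have "E \<inter> snd e = {}" using bnd(4) dom by (auto simp: frontier_def interior_open)
    moreover have "compact (snd e)"
      using bnd(3) open_simplex_props[OF simp[OF bnd(2)]] unfolding facet_of_def
      by (auto intro: face_of_imp_compact[of "closure E"])
    moreover have "snd e \<noteq> {}" using bnd(3) unfolding facet_of_def by blast
    ultimately show ?thesis using bnd(1,2) facet_of_imp_subset[OF bnd(3)] by auto
  qed
  then show "finite (fst e)" "fst e \<subseteq> T_h D" "compact (snd e)" "snd e \<noteq> {}"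
    "\<And>E. E \<in> fst e \<Longrightarrow> snd e \<subseteq> closure E" "\<And>E. E \<in> fst e \<Longrightarrow> E \<inter> snd e = {}" by auto
qed

lemma space_face_measure: "space (face_measure F) = F"
  by (simp add: face_measure_def space_restrict_space)

lemma sets_face_measure: "sets (face_measure F) = sets (restrict_space borel F)"
  by (simp add: face_measure_def)

lemma measurable_face_measure:
  "f \<in> measurable (face_measure F) N \<longleftrightarrow> f \<in> measurable (restrict_space borel F) N"
  by (intro arg_cong[where f = "\<lambda>A. f \<in> A"] measurable_cong_sets sets_face_measure refl)

text \<open>The prism over a compact face is closed, because the projection to the hyperplane is continuous, and bounded.\<close>

lemma finite_measure_face_measure:
  fixes F :: "(real^'n::finite) set"
  assumes F: "compact F" "F \<noteq> {}"
  shows "finite_measure (face_measure F)"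
proof -
  define H where "H = affine hull F"
  define X where "X = {y. infdist y H \<le> 1/2 \<and> closest_point H y \<in> F}"
  have H: "convex H" "closed H" "H \<noteq> {}"
    using F(2) by (simp_all add: H_def affine_imp_convex affine_hull_eq_empty)
  have cont: "continuous_on UNIV (closest_point H)" by (rule continuous_on_closest_point[OF H])
  have "closed {y. infdist y H \<le> 1/2}"
    by (intro closed_Collect_le continuous_on_infdist continuous_on_id continuous_on_const)
  moreover have "closed (closest_point H -` F)"
    using cont F(1) compact_imp_closed by (metis closed_vimage)
  moreover have "X = {y. infdist y H \<le> 1/2} \<inter> closest_point H -` F" by (auto simp: X_def)
  ultimately have X: "closed X" by (simp add: closed_Int)
  have "bounded X"
  proof -
    obtain a r where r: "F \<subseteq> cball a r" using F(1) compact_imp_bounded unfolding bounded_subset_cball by blast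
    have "dist a y \<le> r + 1/2" if "y \<in> X" for y
    proof -
      have "dist y (closest_point H y) = infdist y H"
        using setdist_closest_point[OF H(2,3), of y] by (simp add: infdist_eq_setdist)
      then show ?thesis
        using that r dist_triangle[of a y "closest_point H y"] by (auto simp: X_def dist_commute)
    qed
    then show ?thesis by (intro bounded_subset[OF bounded_cball[of a "r + 1/2"]]) auto
  qed
  then have Xfin: "emeasure lborel X < \<infinity>" by (rule emeasure_bounded_finite)
  have "closest_point H \<in> measurable (restrict_space lborel X) (restrict_space borel F)"
  proof (rule measurable_restrict_space2)
    show "closest_point H \<in> space (restrict_space lborel X) \<rightarrow> F" by (auto simp: X_def space_restrict_space)
    show "closest_point H \<in> measurable (restrict_space lborel X) borel"
      using borel_measurable_continuous_onI[OF cont] by (intro measurable_restrict_space1) simp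
  qed
  moreover have "finite_measure (restrict_space lborel X)"
    using Xfin X by (intro finite_measureI) (simp add: emeasure_restrict_space space_restrict_space)
  ultimately show ?thesis
    unfolding face_measure_def H_def[symmetric] X_def[symmetric] by (intro finite_measure.finite_measure_distr)
qed

text \<open>The affine hull of \<open>F\<close> is a hyperplane, by dimension, so it determines its unit normals up to sign; the
position of \<open>E\<close> fixes the sign.\<close>

lemma outward_normal_eqI:
  fixes E F :: "(real^'n::finite) set"
  assumes n: "norm n = 1" "\<And>x y. x \<in> F \<Longrightarrow> y \<in> F \<Longrightarrow> n \<bullet> (x - y) = 0"
      "\<And>x y. x \<in> E \<Longrightarrow> y \<in> F \<Longrightarrow> n \<bullet> (x - y) < 0"
    and E: "E \<noteq> {}" and F: "aff_dim F = int CARD('n) - 1"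
  shows "outward_normal E F = n"
  unfolding outward_normal_def
proof (rule the_equality)
  show "norm n = 1 \<and> (\<forall>x\<in>F. \<forall>y\<in>F. n \<bullet> (x - y) = 0) \<and> (\<forall>x\<in>E. \<forall>y\<in>F. n \<bullet> (x - y) < 0)"
    using n by blast
next
  fix n' assume n': "norm n' = 1 \<and> (\<forall>x\<in>F. \<forall>y\<in>F. n' \<bullet> (x - y) = 0) \<and> (\<forall>x\<in>E. \<forall>y\<in>F. n' \<bullet> (x - y) < 0)"
  have "F \<noteq> {}" using F by auto
  then obtain y where y: "y \<in> F" by blast
  obtain x where x: "x \<in> E" using E by blast
  have hull: "affine hull F = {x. k \<bullet> x = k \<bullet> y}" if k: "norm k = 1" "\<forall>x\<in>F. \<forall>y\<in>F. k \<bullet> (x - y) = 0" for k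
  proof (rule affine_dim_equal)
    have "k \<noteq> 0" using k(1) by auto
    then show "aff_dim (affine hull F) = aff_dim {x. k \<bullet> x = k \<bullet> y}"
      using F by (simp add: aff_dim_affine_hull)
    have "k \<bullet> x = k \<bullet> y" if "x \<in> F" for x
    proof -
      have "k \<bullet> (x - y) = 0" using k(2) that y by blast
      then show ?thesis by (simp add: inner_diff_right)
    qed
    then have "F \<subseteq> {x. k \<bullet> x = k \<bullet> y}" by blast
    then show "affine hull F \<subseteq> {x. k \<bullet> x = k \<bullet> y}"
      by (rule hull_minimal) (rule affine_hyperplane)
  qed (use y in \<open>auto simp: affine_affine_hull affine_hyperplane hull_inc\<close>)
  have eq: "{x. n' \<bullet> x = n' \<bullet> y} = {x. n \<bullet> x = n \<bullet> y}"
    using hull[of n'] hull[of n] n n' by blast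
  \<comment> \<open>The part of \<open>n'\<close> tangential to the hyperplane; it is orthogonal to both normals.\<close>
  define z where "z = n' - (n \<bullet> n') *\<^sub>R n"
  have nn: "n \<bullet> n = 1" "n' \<bullet> n' = 1" using n(1) n' by (simp_all add: norm_eq_1)
  have "n \<bullet> z = 0" by (simp add: z_def inner_diff_right nn)
  then have "y + z \<in> {x. n' \<bullet> x = n' \<bullet> y}" unfolding eq by (simp add: inner_add_right)
  then have "n' \<bullet> z = 0" by (simp add: inner_add_right)
  with \<open>n \<bullet> z = 0\<close> have "(n' - (n \<bullet> n') *\<^sub>R n) \<bullet> z = 0" by (simp add: inner_diff_left)
  then have "z \<bullet> z = 0" by (simp only: z_def[symmetric])
  then have n'_eq: "n' = (n \<bullet> n') *\<^sub>R n" by (simp add: z_def)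
  have "n' \<bullet> (x - y) = (n \<bullet> n') * (n \<bullet> (x - y))" by (subst n'_eq) simp
  moreover have "n \<bullet> (x - y) < 0" "n' \<bullet> (x - y) < 0" using n(3)[OF x y] n' x y by blast+
  ultimately have "n \<bullet> n' > 0" by (metis mult_neg_neg mult_less_0_iff not_less_iff_gr_or_eq mult_zero_left)
  moreover have "\<bar>n \<bullet> n'\<bar> = 1"
    using n'_eq n(1) n' by (metis norm_scaleR mult.right_neutral)
  ultimately have "n \<bullet> n' = 1" by linarith
  then show "n' = n" using n'_eq by simp
qed

text \<open>A hyperplane separating the two disjoint convex sets contains their common face, and the two open
sets lie strictly on either side of it.\<close>

lemma outward_normals_opposite:
  fixes E1 E2 :: "(real^'n::finite) set"
  assumes E1: "open E1" "convex E1" "E1 \<noteq> {}" and E2: "open E2" "convex E2" "E2 \<noteq> {}"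
    and disj: "E1 \<inter> E2 = {}" and F: "F = closure E1 \<inter> closure E2" "aff_dim F = int CARD('n) - 1"
  shows "outward_normal E2 F = - outward_normal E1 F"
proof -
  obtain a b where a: "a \<noteq> 0" "\<forall>x\<in>E1. a \<bullet> x \<le> b" "\<forall>x\<in>E2. b \<le> a \<bullet> x"
    using separating_hyperplane_sets[OF E1(2) E2(2) E1(3) E2(3) disj] by blast
  have "E1 \<subseteq> interior {x. a \<bullet> x \<le> b}" "E2 \<subseteq> interior {x. a \<bullet> x \<ge> b}"
    using a E1(1) E2(1) by (intro interior_maximal; blast)+
  then have strict: "\<And>x. x \<in> E1 \<Longrightarrow> a \<bullet> x < b" "\<And>x. x \<in> E2 \<Longrightarrow> b < a \<bullet> x"
    using a(1) by auto
  have "closure E1 \<subseteq> {x. a \<bullet> x \<le> b}" "closure E2 \<subseteq> {x. a \<bullet> x \<ge> b}"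
    using a by (intro closure_minimal closed_halfspace_le closed_halfspace_ge; blast)+
  then have onF: "\<And>x. x \<in> F \<Longrightarrow> a \<bullet> x = b" unfolding F(1) by force
  define n where "n = a /\<^sub>R norm a"
  have n: "norm n = 1" "norm (- n) = 1" using a(1) by (simp_all add: n_def)
  have n_dot: "n \<bullet> v = (a \<bullet> v) / norm a" for v by (simp add: n_def divide_inverse_commute)
  have tangent: "n \<bullet> (x - y) = 0" if "x \<in> F" "y \<in> F" for x y
    using onF that by (simp add: n_dot[of "x - y"] inner_diff_right[of a])
  have inward: "n \<bullet> (x - y) < 0" if "x \<in> E1" "y \<in> F" for x y
    unfolding n_dot using strict(1)[OF that(1)] onF[OF that(2)] a(1)
    by (intro divide_neg_pos) (simp_all add: inner_diff_right)
  have outward: "- n \<bullet> (x - y) < 0" if "x \<in> E2" "y \<in> F" for x y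
    using strict(2)[OF that(1)] onF[OF that(2)] a(1) n_dot[of "x - y"]
    by (simp add: inner_diff_right[of a])
  have "outward_normal E1 F = n"
    using n(1) tangent inward E1(3) F(2) by (rule outward_normal_eqI)
  moreover have "outward_normal E2 F = - n"
    using n(2) _ outward E2(3) F(2) by (rule outward_normal_eqI) (simp add: tangent)
  ultimately show ?thesis by simp
qed

section \<open>Piecewise continuous functions and polynomials\<close>

lemma borel_measurable_lebesgue_on_negligible:
  assumes "negligible N"
  shows "f \<in> borel_measurable (lebesgue_on N)"
proof (rule measurableI)
  fix A :: "'b set"
  have "negligible (f -` A \<inter> N)" using assms by (rule negligible_subset) auto
  then have "f -` A \<inter> N \<in> sets lebesgue" by (rule negligible_imp_sets)
  moreover have "N \<in> sets lebesgue" using assms by (rule negligible_imp_sets)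
  ultimately show "f -` A \<inter> space (lebesgue_on N) \<in> sets (lebesgue_on N)"
    by (auto simp: space_restrict_space sets_restrict_space_iff)
qed auto

text \<open>The pieces cover the set except for part of their frontiers, which form a null set; on a null set every
function is measurable because Lebesgue measure is complete.\<close>

lemma piecewise_continuous_measurable:
  fixes \<Omega> :: "(real^'n::finite) set"
  assumes g: "piecewise_continuous \<Omega> g" and \<Omega>: "open \<Omega>"
  shows "g \<in> borel_measurable (lebesgue_on \<Omega>)"
proof -
  obtain T where T: "subdivision \<Omega> T" and
    g': "\<And>E. E \<in> T \<Longrightarrow> \<exists>g'. continuous_on (closure E) g' \<and> (\<forall>x\<in>E. g x = g' x)"
    using g unfolding piecewise_continuous_def by blast
  have E: "open_simplex E" "E \<subseteq> \<Omega>" if "E \<in> T" for E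
    using T that unfolding subdivision_def by blast+
  have fin: "finite T" and cover: "\<Omega> \<subseteq> (\<Union>E\<in>T. closure E)" using T unfolding subdivision_def by blast+
  define N where "N = \<Omega> - \<Union>T"
  have "negligible (\<Union>E\<in>T. frontier E)"
    using fin by (intro negligible_Union) (auto intro!: negligible_convex_frontier open_simplex_props(3)[OF E(1)])
  moreover have "N \<subseteq> (\<Union>E\<in>T. frontier E)"
  proof
    fix x assume x: "x \<in> N"
    then obtain E where E': "E \<in> T" "x \<in> closure E" using cover unfolding N_def by blast
    then have "x \<in> frontier E" using x open_simplex_props(1)[OF E(1)[OF E'(1)]]
      by (auto simp: N_def frontier_def interior_open)
    then show "x \<in> (\<Union>E\<in>T. frontier E)" using E'(1) by blast
  qed
  ultimately have N: "negligible N" by (rule negligible_subset)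
  have \<Omega>s: "\<Omega> \<in> sets lebesgue" using \<Omega> by auto
  have restr: "restrict_space (lebesgue_on \<Omega>) A = lebesgue_on A" if "A \<in> sets lebesgue" "A \<subseteq> \<Omega>" for A
    using that \<Omega>s by (simp add: restrict_restrict_space Int_absorb1)
  have Es: "E \<in> sets lebesgue" if "E \<in> T" for E using open_simplex_props(1)[OF E(1)[OF that]] by auto
  show ?thesis
  proof (rule measurable_piecewise_restrict[where C = "insert N T"])
    show "countable (insert N T)" using fin by (simp add: countable_finite)
    show "space (lebesgue_on \<Omega>) \<subseteq> \<Union> (insert N T)" by (auto simp: N_def)
    fix A assume A: "A \<in> insert N T"
    then have As: "A \<in> sets lebesgue" "A \<subseteq> \<Omega>"
      using negligible_imp_sets[OF N] Es E(2) by (auto simp: N_def)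
    then show "A \<inter> space (lebesgue_on \<Omega>) \<in> sets (lebesgue_on \<Omega>)"
      using \<Omega>s by (simp add: sets_restrict_space_iff Int_absorb2)
    show "g \<in> borel_measurable (restrict_space (lebesgue_on \<Omega>) A)"
      unfolding restr[OF As]
    proof (cases "A = N")
      case True
      then show "g \<in> borel_measurable (lebesgue_on A)"
        using borel_measurable_lebesgue_on_negligible[OF N] by simp
    next
      case False
      then have "A \<in> T" using A by blast
      then obtain h where h: "continuous_on (closure A) h" "\<forall>x\<in>A. g x = h x" using g' by blast
      then have "continuous_on A g"
        by (metis closure_subset continuous_on_subset continuous_on_cong)
      then show "g \<in> borel_measurable (lebesgue_on A)"
        using As(1) by (rule continuous_imp_measurable_on_sets_lebesgue)
    qed
  qed
qed

lemma polys_C1: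
  fixes p :: "real^'n::finite \<Rightarrow> real"
  assumes "p \<in> polys r"
  shows "\<And>x. p differentiable (at x)" "continuous_on UNIV p" "continuous_on UNIV (grad p)"
proof -
  obtain a where p: "p = (\<lambda>x. \<Sum>\<alpha> | sum \<alpha> UNIV \<le> r. a (\<alpha> :: 'n \<Rightarrow> nat) * (\<Prod>i\<in>UNIV. x $ i ^ \<alpha> i))"
    using assms unfolding polys_def by blast
  define p' where "p' x h = (\<Sum>\<alpha> | sum \<alpha> UNIV \<le> r. a (\<alpha> :: 'n \<Rightarrow> nat) *
      (\<Sum>i\<in>UNIV. (of_nat (\<alpha> i) * h $ i * x $ i ^ (\<alpha> i - 1)) * (\<Prod>j\<in>UNIV - {i}. x $ j ^ \<alpha> j)))"
    for x h :: "real^'n"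
  have deriv: "(p has_derivative p' x) (at x)" for x
    unfolding p p'_def
    by (rule has_derivative_sum, rule has_derivative_mult_right, rule has_derivative_prod,
        rule has_derivative_power, rule bounded_linear_imp_has_derivative, rule bounded_linear_vec_nth)
  show "p differentiable (at x)" for x using deriv differentiable_def by blast
  then show "continuous_on UNIV p"
    by (simp add: differentiable_imp_continuous_within continuous_at_imp_continuous_on)
  have "frechet_derivative p (at x) = p' x" for x
    using frechet_derivative_at[OF deriv] by simp
  then have "grad p = (\<lambda>x. \<chi> i. p' x (axis i 1))" by (simp add: grad_def fun_eq_iff)
  moreover have "continuous_on UNIV (\<lambda>x. \<chi> i. p' x (axis i 1))"
    unfolding p'_def by (intro continuous_intros)
  ultimately show "continuous_on UNIV (grad p)" by simp
qed

lemma polys_add: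
  assumes "p \<in> polys r" "q \<in> polys r"
  shows "(\<lambda>x. p x + q x) \<in> polys r"
proof -
  obtain a b where "p = (\<lambda>x. \<Sum>\<alpha> | sum \<alpha> UNIV \<le> r. a \<alpha> * (\<Prod>i\<in>UNIV. x $ i ^ \<alpha> i))"
    "q = (\<lambda>x. \<Sum>\<alpha> | sum \<alpha> UNIV \<le> r. b \<alpha> * (\<Prod>i\<in>UNIV. x $ i ^ \<alpha> i))"
    using assms unfolding polys_def by blast
  then have "(\<lambda>x. p x + q x) = (\<lambda>x. \<Sum>\<alpha> | sum \<alpha> UNIV \<le> r. (a \<alpha> + b \<alpha>) * (\<Prod>i\<in>UNIV. x $ i ^ \<alpha> i))"
    by (simp add: sum.distrib distrib_right)
  then show ?thesis unfolding polys_def by (rule range_eqI[where x = "\<lambda>\<alpha>. a \<alpha> + b \<alpha>"])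
qed

lemma polys_cmult:
  assumes "p \<in> polys r"
  shows "(\<lambda>x. c * p x) \<in> polys r"
proof -
  obtain a where "p = (\<lambda>x. \<Sum>\<alpha> | sum \<alpha> UNIV \<le> r. a \<alpha> * (\<Prod>i\<in>UNIV. x $ i ^ \<alpha> i))"
    using assms unfolding polys_def by blast
  then have "(\<lambda>x. c * p x) = (\<lambda>x. \<Sum>\<alpha> | sum \<alpha> UNIV \<le> r. (c * a \<alpha>) * (\<Prod>i\<in>UNIV. x $ i ^ \<alpha> i))"
    by (simp add: sum_distrib_left mult.assoc)
  then show ?thesis unfolding polys_def by (rule range_eqI[where x = "\<lambda>\<alpha>. c * a \<alpha>"])
qed

lemma finite_multi_indices: "finite {\<alpha> :: 'n::finite \<Rightarrow> nat. sum \<alpha> UNIV \<le> r}"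
proof (rule finite_subset)
  show "{\<alpha> :: 'n \<Rightarrow> nat. sum \<alpha> UNIV \<le> r} \<subseteq> PiE UNIV (\<lambda>_. {..r})"
  proof
    fix \<alpha> :: "'n \<Rightarrow> nat" assume "\<alpha> \<in> {\<alpha>. sum \<alpha> UNIV \<le> r}"
    then have "\<alpha> i \<le> r" for i using member_le_sum[of i UNIV \<alpha>] by simp
    then show "\<alpha> \<in> PiE UNIV (\<lambda>_. {..r})" by auto
  qed
  show "finite (PiE (UNIV :: 'n set) (\<lambda>_. {..r}))" by (intro finite_PiE) auto
qed

section \<open>The discontinuous finite element space\<close>

lemma V_dG_subspace: "subspace (V_dG D)"
proof (rule subspaceI)
  have "polys r \<noteq> ({} :: (real^'n::finite \<Rightarrow> real) set)" for r unfolding polys_def by blast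
  then have zero: "(\<lambda>x. 0) \<in> (polys r :: (real^'n::finite \<Rightarrow> real) set)" for r
    using polys_cmult[of _ r 0] by fastforce
  show "0 \<in> V_dG D"
    by (auto simp: V_dG_def square_integrable_def zero_fun_def intro!: bexI[OF _ zero])
next
  fix u v assume u: "u \<in> V_dG D" and v: "v \<in> V_dG D"
  have sq: "square_integrable (Omega D) (u + v)"
  proof -
    have m: "u \<in> borel_measurable (lebesgue_on (Omega D))" "v \<in> borel_measurable (lebesgue_on (Omega D))"
      and i: "integrable (lebesgue_on (Omega D)) (\<lambda>x. (u x)\<^sup>2)" "integrable (lebesgue_on (Omega D)) (\<lambda>x. (v x)\<^sup>2)"
      using u v unfolding V_dG_def square_integrable_def by blast+
    have "integrable (lebesgue_on (Omega D)) (\<lambda>x. (u x + v x)\<^sup>2)"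
    proof (rule Bochner_Integration.integrable_bound)
      show "integrable (lebesgue_on (Omega D)) (\<lambda>x. 2 * (u x)\<^sup>2 + 2 * (v x)\<^sup>2)" using i by simp
      show "(\<lambda>x. (u x + v x)\<^sup>2) \<in> borel_measurable (lebesgue_on (Omega D))" using m by measurable
      have "(u x + v x)\<^sup>2 \<le> 2 * (u x)\<^sup>2 + 2 * (v x)\<^sup>2" for x
        using zero_le_power2[of "u x - v x"] by (simp add: power2_eq_square algebra_simps)
      then show "AE x in lebesgue_on (Omega D). norm ((u x + v x)\<^sup>2) \<le> norm (2 * (u x)\<^sup>2 + 2 * (v x)\<^sup>2)" by simp
    qed
    then show ?thesis using m unfolding square_integrable_def plus_fun_def by (simp add: borel_measurable_add)
  qed
  have "\<exists>p\<in>polys (deg D). \<forall>x\<in>E. (u + v) x = p x" if "E \<in> T_h D" for E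
  proof -
    obtain p q where "p \<in> polys (deg D)" "\<forall>x\<in>E. u x = p x" "q \<in> polys (deg D)" "\<forall>x\<in>E. v x = q x"
      using u v \<open>E \<in> T_h D\<close> unfolding V_dG_def by blast
    then show ?thesis using polys_add by (intro bexI[of _ "\<lambda>x. p x + q x"]) auto
  qed
  then show "u + v \<in> V_dG D" using u v sq by (simp add: V_dG_def)
next
  fix c :: real and v assume v: "v \<in> V_dG D"
  have "square_integrable (Omega D) (c *\<^sub>R v)"
    using v by (auto simp: V_dG_def square_integrable_def scaleR_fun_def power_mult_distrib)
  moreover have "\<exists>p\<in>polys (deg D). \<forall>x\<in>E. (c *\<^sub>R v) x = p x" if "E \<in> T_h D" for E
  proof -
    obtain p where "p \<in> polys (deg D)" "\<forall>x\<in>E. v x = p x"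
      using v \<open>E \<in> T_h D\<close> unfolding V_dG_def by blast
    then show ?thesis using polys_cmult by (intro bexI[of _ "\<lambda>x. c * p x"]) (auto simp: scaleR_fun_def)
  qed
  ultimately show "c *\<^sub>R v \<in> V_dG D" using v by (simp add: V_dG_def scaleR_fun_def)
qed

lemma sum_fun_apply: "(\<Sum>i\<in>A. f i :: 'a \<Rightarrow> 'b::comm_monoid_add) x = (\<Sum>i\<in>A. f i x)"
  by (induction A rule: infinite_finite_induct) auto

text \<open>A spanning set: the monomials cut off to single elements. Because members of the space vanish
outside the elements, they are genuinely equal to a combination of these functions, not just almost everywhere.\<close>

lemma V_dG_finite_dim:
  assumes mesh: "subdivision (Omega D) (T_h D)"
  shows "\<exists>G. finite G \<and> V_dG (D :: ('n::finite) cdg) \<subseteq> span G"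
proof -
  let ?I = "{\<alpha> :: 'n \<Rightarrow> nat. sum \<alpha> UNIV \<le> deg D}"
  define m where "m E \<alpha> = (\<lambda>x::real^'n. if x \<in> E then (\<Prod>i\<in>UNIV. x $ i ^ \<alpha> i) else 0)" for E \<alpha>
  define G where "G = (\<lambda>(E, \<alpha>). m E \<alpha>) ` (T_h D \<times> ?I)"
  have fin: "finite (T_h D)" and disj: "pairwise disjnt (T_h D)"
    using mesh unfolding subdivision_def by blast+
  have "v \<in> span G" if v: "v \<in> V_dG D" for v
  proof -
    have "\<exists>a. \<forall>x\<in>E. v x = (\<Sum>\<alpha>\<in>?I. a \<alpha> * (\<Prod>i\<in>UNIV. x $ i ^ \<alpha> i))"
      if E: "E \<in> T_h D" for E
    proof -
      obtain p where p: "p \<in> polys (deg D)" "\<forall>x\<in>E. v x = p x" using v E unfolding V_dG_def by blast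
      obtain a where "p = (\<lambda>x. \<Sum>\<alpha>\<in>?I. a \<alpha> * (\<Prod>i\<in>UNIV. x $ i ^ \<alpha> i))"
        using p(1) unfolding polys_def by (rule rangeE)
      then show ?thesis using p(2) by auto
    qed
    then have "\<exists>a. \<forall>E\<in>T_h D. \<forall>x\<in>E. v x = (\<Sum>\<alpha>\<in>?I. a E \<alpha> * (\<Prod>i\<in>UNIV. x $ i ^ \<alpha> i))"
      by (intro bchoice ballI)
    then obtain a where a: "\<And>E x. E \<in> T_h D \<Longrightarrow> x \<in> E \<Longrightarrow> v x = (\<Sum>\<alpha>\<in>?I. a E \<alpha> * (\<Prod>i\<in>UNIV. x $ i ^ \<alpha> i))"
      by blast
    have "v x = (\<Sum>E\<in>T_h D. \<Sum>\<alpha>\<in>?I. a E \<alpha> * m E \<alpha> x)" for x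
    proof (cases "x \<in> \<Union>(T_h D)")
      case True
      then obtain E where E: "E \<in> T_h D" "x \<in> E" by blast
      have "x \<notin> E'" if "E' \<in> T_h D - {E}" for E'
        using disj E that unfolding pairwise_def disjnt_def by blast
      then have "(\<Sum>E'\<in>T_h D - {E}. \<Sum>\<alpha>\<in>?I. a E' \<alpha> * m E' \<alpha> x) = 0" by (simp add: m_def)
      then show ?thesis using sum.remove[OF fin E(1), of "\<lambda>E. \<Sum>\<alpha>\<in>?I. a E \<alpha> * m E \<alpha> x"] a[OF E] E(2) by (simp add: m_def)
    next
      case False
      then have "m E \<alpha> x = 0" if "E \<in> T_h D" for E \<alpha> using that by (auto simp: m_def)
      then show ?thesis using v False by (simp add: V_dG_def)
    qed
    then have "v = (\<Sum>E\<in>T_h D. \<Sum>\<alpha>\<in>?I. a E \<alpha> *\<^sub>R m E \<alpha>)"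
      by (auto simp: fun_eq_iff sum_fun_apply scaleR_fun_def)
    moreover have "(\<Sum>E\<in>T_h D. \<Sum>\<alpha>\<in>?I. a E \<alpha> *\<^sub>R m E \<alpha>) \<in> span G"
      by (intro span_sum span_scale span_base) (auto simp: G_def)
    ultimately show ?thesis by simp
  qed
  moreover have "finite G" unfolding G_def by (intro finite_imageI finite_cartesian_product fin finite_multi_indices)
  ultimately show ?thesis by blast
qed

text \<open>On an element a finite element function and its gradient are restrictions of functions that are
continuous on the whole space, which gives boundedness inside the element and limits on its closure.\<close>

lemma V_dG_on_element:
  assumes v: "v \<in> V_dG D" and E: "E \<in> T_h D" "open E"
  obtains p where "continuous_on UNIV p" "continuous_on UNIV (grad p)"
    "\<And>x. x \<in> E \<Longrightarrow> v x = p x" "\<And>x. x \<in> E \<Longrightarrow> grad v x = grad p x"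
    "\<And>x. x \<in> E \<Longrightarrow> v differentiable (at x)"
proof -
  obtain p where p: "p \<in> polys (deg D)" "\<And>x. x \<in> E \<Longrightarrow> v x = p x"
    using v E(1) unfolding V_dG_def by blast
  note C1 = polys_C1[OF p(1)]
  have "grad v x = grad p x" if "x \<in> E" for x
    unfolding grad_def using frechet_derivative_transform_within_open[OF C1(1) E(2) that, of v] p(2) by simp
  moreover have "v differentiable (at x)" if "x \<in> E" for x
  proof -
    obtain d where d: "(p has_derivative d) (at x)" using C1(1) unfolding differentiable_def by blast
    have "(v has_derivative d) (at x)"
      by (rule has_derivative_transform_within_open[OF d E(2) that]) (simp add: p(2))
    then show ?thesis unfolding differentiable_def by blast
  qed
  ultimately show ?thesis using that[of p] C1(2,3) p(2) by blast
qed

section \<open>Traces and integrands in the finite element setting\<close>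

lemma bounded_measurable_cong:
  assumes "\<And>x. x \<in> space M \<Longrightarrow> f x = g x"
  shows "bounded_measurable M f \<longleftrightarrow> bounded_measurable M g"
  using assms measurable_cong[of M f g borel]
  by (auto simp: bounded_measurable_def cong: AE_cong)

lemma bounded_measurable_lebesgue_on_continuous:
  assumes E: "E \<in> sets lebesgue" "compact (closure E)" and f: "continuous_on (closure E) f"
  shows "bounded_measurable (lebesgue_on E) f"
proof -
  have "compact (f ` closure E)" using f E(2) by (rule compact_continuous_image)
  then obtain K where K: "\<forall>y\<in>f ` closure E. norm y \<le> K"
    using compact_imp_bounded bounded_iff by blast
  have "continuous_on E f" using f closure_subset continuous_on_subset by blast
  then have "f \<in> borel_measurable (lebesgue_on E)"
    using E(1) by (rule continuous_imp_measurable_on_sets_lebesgue)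
  moreover have "norm (f x) \<le> K" if "x \<in> E" for x using K closure_subset that by blast
  ultimately show ?thesis by (intro bounded_measurableI) auto
qed

lemma bounded_measurable_face_measure_continuous:
  assumes F: "compact F" and f: "continuous_on F f"
  shows "bounded_measurable (face_measure F) f"
proof -
  have "compact (f ` F)" using f F by (rule compact_continuous_image)
  then obtain K where "\<forall>y\<in>f ` F. norm y \<le> K" using compact_imp_bounded bounded_iff by blast
  then show ?thesis
    using borel_measurable_continuous_on_restrict[OF f]
    by (intro bounded_measurableI) (auto simp: space_face_measure measurable_face_measure)
qed

context cdg_setting
begin

lemma element_props:
  assumes "E \<in> T_h D"
  shows "open E" "E \<noteq> {}" "convex E" "bounded E" "compact (closure E)" "E \<subseteq> Omega D"
    "closure E \<subseteq> closure (Omega D)" "E \<in> sets lebesgue"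
proof -
  have "open_simplex E" and sub: "E \<subseteq> Omega D" using mesh assms unfolding subdivision_def by blast+
  then show "open E" "E \<noteq> {}" "convex E" "bounded E" "compact (closure E)" "E \<subseteq> Omega D"
    using open_simplex_props by blast+
  then show "E \<in> sets lebesgue" by auto
  show "closure E \<subseteq> closure (Omega D)" using sub by (rule closure_mono)
qed

lemmas face_props = face_props[OF mesh domain(1)]

lemma finite_measure_element: "E \<in> T_h D \<Longrightarrow> finite_measure (lebesgue_on E)"
  using element_props by (intro finite_measure_lebesgue_on lmeasurable_open) auto

lemma finite_measure_face: "e \<in> faces D \<Longrightarrow> finite_measure (face_measure (snd e))"
  using face_props by (intro finite_measure_face_measure) auto

lemma continuous_on_conv: "continuous_on (closure (Omega D)) (conv D)"
proof -
  have "continuous_on (closure (Omega D)) (\<lambda>x. conv D x $ i)" for i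
    using b_Lipschitz lipschitz_on_continuous_on by blast
  then have "continuous_on (closure (Omega D)) (\<lambda>x. \<chi> i. conv D x $ i)" by (rule continuous_on_vec_lambda)
  then show ?thesis by simp
qed

lemma restrict_to_element:
  assumes "E \<in> T_h D"
  shows "restrict_space (lebesgue_on (Omega D)) E = lebesgue_on E"
  using element_props[OF assms] domain(1) by (simp add: restrict_restrict_space Int_absorb1)

lemma measurable_element:
  assumes "E \<in> T_h D" "f \<in> measurable (lebesgue_on (Omega D)) N"
  shows "f \<in> measurable (lebesgue_on E) N"
  using measurable_restrict_space1[OF assms(2), of E] restrict_to_element[OF assms(1)] by simp

lemma AE_element:
  assumes E: "E \<in> T_h D" and ae: "AE x in lebesgue_on (Omega D). P x"
  shows "AE x in lebesgue_on E. P x"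
proof -
  have "Omega D \<in> sets lebesgue" using domain(1) by auto
  then show ?thesis using ae element_props(6,8)[OF E]
    by (auto simp: AE_restrict_space_iff)
qed

lemma diff_bounded: "\<exists>K. \<forall>x\<in>closure (Omega D). norm (diff D x) \<le> K"
proof -
  have "\<forall>i j. \<exists>K. \<forall>x\<in>closure (Omega D). \<bar>diff D x $ i $ j\<bar> \<le> K"
    using A_bounded unfolding bounded_iff by auto
  then obtain K where K: "\<And>i j x. x \<in> closure (Omega D) \<Longrightarrow> \<bar>diff D x $ i $ j\<bar> \<le> K i j" by metis
  have "norm (diff D x) \<le> (\<Sum>i\<in>UNIV. \<Sum>j\<in>UNIV. K i j)" if x: "x \<in> closure (Omega D)" for x
  proof -
    have "norm (diff D x) \<le> (\<Sum>i\<in>UNIV. norm (diff D x $ i))"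
      unfolding norm_vec_def by (rule L2_set_le_sum) simp
    also have "\<dots> \<le> (\<Sum>i\<in>UNIV. \<Sum>j\<in>UNIV. K i j)"
      by (intro sum_mono order_trans[OF norm_le_l1_cart] K[OF x])
    finally show ?thesis .
  qed
  then show ?thesis by blast
qed

lemma bounded_measurable_diff_element:
  assumes E: "E \<in> T_h D"
  shows "bounded_measurable (lebesgue_on E) (diff D)"
proof -
  have comp: "(\<lambda>x. diff D x $ i $ j) \<in> borel_measurable (lebesgue_on E)" for i j
    by (rule measurable_element[OF E piecewise_continuous_measurable[OF A_piecewise domain(1)]])
  have "(\<lambda>x. diff D x \<bullet> b) \<in> borel_measurable (lebesgue_on E)" if "b \<in> Basis" for b
    using that comp by (auto simp: Basis_vec_def inner_axis)
  then have "diff D \<in> borel_measurable (lebesgue_on E)"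
    using borel_measurable_euclidean_space by blast
  moreover obtain K where "\<forall>x\<in>closure (Omega D). norm (diff D x) \<le> K" using diff_bounded by blast
  then have "norm (diff D x) \<le> K" if "x \<in> E" for x
    using element_props(6)[OF E] closure_subset that by blast
  ultimately show ?thesis by (intro bounded_measurableI) auto
qed

lemma bounded_measurable_conv_element:
  assumes E: "E \<in> T_h D"
  shows "bounded_measurable (lebesgue_on E) (conv D)"
  using element_props[OF E] continuous_on_subset[OF continuous_on_conv]
  by (intro bounded_measurable_lebesgue_on_continuous) auto

lemma bounded_measurable_reac_element:
  assumes E: "E \<in> T_h D"
  shows "bounded_measurable (lebesgue_on E) (reac D)"
proof -
  obtain K where "AE x in lebesgue_on (Omega D). \<bar>reac D x\<bar> \<le> K"
    and m: "reac D \<in> borel_measurable (lebesgue_on (Omega D))"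
    using c_bounded unfolding essentially_bounded_def by blast
  then have "AE x in lebesgue_on E. \<bar>reac D x\<bar> \<le> K" by (intro AE_element[OF E])
  then show ?thesis
    using measurable_element[OF E m] unfolding bounded_measurable_def by auto
qed

lemma bounded_measurable_V_element:
  assumes E: "E \<in> T_h D" and v: "v \<in> V_dG D"
  shows "bounded_measurable (lebesgue_on E) v" "bounded_measurable (lebesgue_on E) (grad v)"
proof -
  obtain p where p: "continuous_on UNIV p" "continuous_on UNIV (grad p)"
    "\<And>x. x \<in> E \<Longrightarrow> v x = p x" "\<And>x. x \<in> E \<Longrightarrow> grad v x = grad p x"
    using V_dG_on_element[OF v E element_props(1)[OF E]] by metis
  have "bounded_measurable (lebesgue_on E) p" "bounded_measurable (lebesgue_on E) (grad p)"
    using p(1,2) element_props(5,8)[OF E]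
    by (auto intro!: bounded_measurable_lebesgue_on_continuous intro: continuous_on_subset)
  then show "bounded_measurable (lebesgue_on E) v" "bounded_measurable (lebesgue_on E) (grad v)"
    using p(3,4) bounded_measurable_cong[of "lebesgue_on E" v p]
      bounded_measurable_cong[of "lebesgue_on E" "grad v" "grad p"] by simp_all
qed

lemma V_trace_limits:
  assumes v: "v \<in> V_dG D" and E: "E \<in> T_h D"
  obtains p q where "continuous_on UNIV p" "continuous_on UNIV q"
    "\<And>x. (v \<longlongrightarrow> p x) (at x within E)" "\<And>x. (grad v \<longlongrightarrow> q x) (at x within E)"
proof -
  obtain p where p: "continuous_on UNIV p" "continuous_on UNIV (grad p)"
    "\<And>x. x \<in> E \<Longrightarrow> v x = p x" "\<And>x. x \<in> E \<Longrightarrow> grad v x = grad p x"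
    using V_dG_on_element[OF v E element_props(1)[OF E]] by metis
  have "(v \<longlongrightarrow> p x) (at x within E)" for x
  proof (rule Lim_transform_eventually)
    show "(p \<longlongrightarrow> p x) (at x within E)"
      using p(1) unfolding continuous_on_def by (meson UNIV_I subset_UNIV tendsto_within_subset)
    show "eventually (\<lambda>y. p y = v y) (at x within E)" using p(3) by (simp add: eventually_at_filter)
  qed
  moreover have "(grad v \<longlongrightarrow> grad p x) (at x within E)" for x
  proof (rule Lim_transform_eventually)
    show "(grad p \<longlongrightarrow> grad p x) (at x within E)"
      using p(2) unfolding continuous_on_def by (meson UNIV_I subset_UNIV tendsto_within_subset)
    show "eventually (\<lambda>y. grad p y = grad v y) (at x within E)" using p(4) by (simp add: eventually_at_filter)
  qed
  ultimately show ?thesis using that p(1,2) by blast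
qed

lemma on_face:
  assumes "e \<in> faces D" "E \<in> fst e"
  shows "E \<in> T_h D" "\<And>x. x \<in> snd e \<Longrightarrow> x \<in> closure E" "\<And>x. x \<in> snd e \<Longrightarrow> x \<notin> E"
  using face_props[OF assms(1)] assms(2) by blast+

lemma bounded_measurable_trace:
  assumes e: "e \<in> faces D" "E \<in> fst e" and v: "v \<in> V_dG D"
  shows "bounded_measurable (face_measure (snd e)) (trace_from E v)"
    "bounded_measurable (face_measure (snd e)) (trace_from E (grad v))"
proof -
  note E = on_face[OF e]
  obtain p q where p: "continuous_on UNIV p" "continuous_on UNIV q"
    "\<And>x. (v \<longlongrightarrow> p x) (at x within E)" "\<And>x. (grad v \<longlongrightarrow> q x) (at x within E)"
    using V_trace_limits[OF v E(1)] by metis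
  have "trace_from E v x = p x" "trace_from E (grad v) x = q x" if "x \<in> snd e" for x
    using trace_from_eq p(3,4) E(2,3)[OF that] by blast+
  moreover have "bounded_measurable (face_measure (snd e)) p" "bounded_measurable (face_measure (snd e)) q"
    using p(1,2) face_props(3)[OF e(1)]
    by (auto intro!: bounded_measurable_face_measure_continuous intro: continuous_on_subset)
  ultimately show "bounded_measurable (face_measure (snd e)) (trace_from E v)"
    "bounded_measurable (face_measure (snd e)) (trace_from E (grad v))"
    using bounded_measurable_cong[of "face_measure (snd e)" "trace_from E v" p]
      bounded_measurable_cong[of "face_measure (snd e)" "trace_from E (grad v)" q]
    by (simp_all add: space_face_measure)
qed

text \<open>The mesh need not resolve the discontinuities of the diffusion matrix, so the trace may fail to exist at points of the face.\<close>

lemma bounded_measurable_trace_diff: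
  assumes e: "e \<in> faces D" "E \<in> fst e"
  shows "bounded_measurable (face_measure (snd e)) (trace_from E (diff D))"
proof -
  note E = on_face[OF e]
  obtain K where K: "\<forall>x\<in>closure (Omega D). norm (diff D x) \<le> K" using diff_bounded by blast
  have "norm (diff D y) \<le> K" if "y \<in> E" for y
    using K element_props(6)[OF E(1)] closure_subset that by blast
  then have "norm (trace_from E (diff D) x) \<le> max K (norm (THE l::real^'n^'n. False))"
    if "x \<in> snd e" for x
    using norm_trace_from_le E(2,3)[OF that] by blast
  moreover have "trace_from E (diff D) \<in> borel_measurable (restrict_space borel (snd e))"
    using face_props[OF e(1)] e(2) by (intro borel_measurable_trace_from) (auto intro: borel_compact)
  ultimately show ?thesis
    by (intro bounded_measurableI) (auto simp: space_face_measure measurable_face_measure)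
qed

lemma continuous_on_conv_face: "e \<in> faces D \<Longrightarrow> continuous_on (snd e) (conv D)"
proof -
  assume e: "e \<in> faces D"
  obtain E where E: "E \<in> fst e"
    using e unfolding faces_def interior_faces_def boundary_faces_def by fastforce
  have "snd e \<subseteq> closure (Omega D)"
    using on_face(1,2)[OF e E] element_props(7) by blast
  then show "continuous_on (snd e) (conv D)" using continuous_on_conv continuous_on_subset by blast
qed

lemma bounded_measurable_conv_face:
  "e \<in> faces D \<Longrightarrow> bounded_measurable (face_measure (snd e)) (conv D)"
  using continuous_on_conv_face face_props(3) by (intro bounded_measurable_face_measure_continuous)

lemma linear_element:
  assumes E: "E \<in> T_h D" "x \<in> E"
  shows "linear_form_on (V_dG D) (\<lambda>v. v x)" "linear_form_on (V_dG D) (\<lambda>v. grad v x)"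
proof -
  show "linear_form_on (V_dG D) (\<lambda>v. v x)"
    by (simp add: linear_form_on_def scaleR_fun_def)
  have d: "v differentiable (at x)" if "v \<in> V_dG D" for v
    using V_dG_on_element[OF that E(1) element_props(1)[OF E(1)]] E(2) by metis
  have fd: "(v has_derivative frechet_derivative v (at x)) (at x)" if "v \<in> V_dG D" for v
    using d[OF that] frechet_derivative_works by blast
  have "frechet_derivative (u + v) (at x) = (\<lambda>h. frechet_derivative u (at x) h + frechet_derivative v (at x) h)"
    if "u \<in> V_dG D" "v \<in> V_dG D" for u v
    unfolding plus_fun_def
    by (rule frechet_derivative_at[symmetric]) (intro has_derivative_add fd that)
  then have "grad (u + v) x = grad u x + grad v x" if "u \<in> V_dG D" "v \<in> V_dG D" for u v
    using that by (simp add: grad_def vec_eq_iff)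
  moreover have "frechet_derivative (a *\<^sub>R v) (at x) = (\<lambda>h. a *\<^sub>R frechet_derivative v (at x) h)"
    if "v \<in> V_dG D" for a v
    unfolding scaleR_fun_def
    by (rule frechet_derivative_at[symmetric]) (intro has_derivative_scaleR_right fd that)
  then have "grad (a *\<^sub>R v) x = a *\<^sub>R grad v x" if "v \<in> V_dG D" for a v
    using that by (simp add: grad_def vec_eq_iff)
  ultimately show "linear_form_on (V_dG D) (\<lambda>v. grad v x)" unfolding linear_form_on_def by blast
qed

lemma linear_trace:
  assumes e: "e \<in> faces D" "E \<in> fst e" "x \<in> snd e"
  shows "linear_form_on (V_dG D) (\<lambda>v. trace_from E v x)"
    "linear_form_on (V_dG D) (\<lambda>v. trace_from E (grad v) x)"
proof -
  note E = on_face[OF e(1,2)]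
  note eq = trace_from_eq[OF _ E(2)[OF e(3)] E(3)[OF e(3)]]
  have lim: "(v \<longlongrightarrow> trace_from E v x) (at x within E)"
    "(grad v \<longlongrightarrow> trace_from E (grad v) x) (at x within E)" if "v \<in> V_dG D" for v
    using V_trace_limits[OF that E(1)] eq by metis+
  have "trace_from E (u + v) x = trace_from E u x + trace_from E v x"
    if "u \<in> V_dG D" "v \<in> V_dG D" for u v
    unfolding plus_fun_def by (intro eq tendsto_add lim that)
  moreover have "trace_from E (a *\<^sub>R v) x = a *\<^sub>R trace_from E v x" if "v \<in> V_dG D" for a v
    unfolding scaleR_fun_def by (intro eq tendsto_scaleR tendsto_const lim that)
  ultimately show "linear_form_on (V_dG D) (\<lambda>v. trace_from E v x)"
    unfolding linear_form_on_def by blast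
  have "trace_from E (grad (u + v)) x = trace_from E (grad u) x + trace_from E (grad v) x"
    if "u \<in> V_dG D" "v \<in> V_dG D" for u v
  proof (rule eq, rule Lim_transform_eventually)
    show "((\<lambda>y. grad u y + grad v y) \<longlongrightarrow> trace_from E (grad u) x + trace_from E (grad v) x) (at x within E)"
      by (intro tendsto_add lim that)
    show "eventually (\<lambda>y. grad u y + grad v y = grad (u + v) y) (at x within E)"
      using linear_element(2)[OF E(1)] that by (simp add: eventually_at_filter linear_form_on_def)
  qed
  moreover have "trace_from E (grad (a *\<^sub>R v)) x = a *\<^sub>R trace_from E (grad v) x" if "v \<in> V_dG D" for a v
  proof (rule eq, rule Lim_transform_eventually)
    show "((\<lambda>y. a *\<^sub>R grad v y) \<longlongrightarrow> a *\<^sub>R trace_from E (grad v) x) (at x within E)"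
      by (intro tendsto_scaleR tendsto_const lim that)
    show "eventually (\<lambda>y. a *\<^sub>R grad v y = grad (a *\<^sub>R v) y) (at x within E)"
      using linear_element(2)[OF E(1)] that by (simp add: eventually_at_filter linear_form_on_def)
  qed
  ultimately show "linear_form_on (V_dG D) (\<lambda>v. trace_from E (grad v) x)"
    unfolding linear_form_on_def by blast
qed

section \<open>The bilinear forms\<close>

lemma linear_jump:
  assumes e: "e \<in> faces D" "x \<in> snd e"
  shows "linear_form_on (V_dG D) (\<lambda>v. jump e v x)"
  unfolding jump_def
  by (intro linear_form_on_sum linear_form_on_compose[OF _ linear_trace(1)[OF e(1) _ e(2)]]) (simp add: linear_iff algebra_simps)

lemma bounded_measurable_jump:
  assumes e: "e \<in> faces D" and v: "v \<in> V_dG D"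
  shows "bounded_measurable (face_measure (snd e)) (jump e v)"
  unfolding jump_def[abs_def]
  by (intro bounded_measurable_sum bounded_measurable_scaleR bounded_measurable_trace[OF e _ v]
      bounded_measurable_const)

lemma linear_flux_average:
  assumes e: "e \<in> faces D" "x \<in> snd e"
  shows "linear_form_on (V_dG D) (\<lambda>v. flux_average D e v x)"
proof -
  have "linear_form_on (V_dG D) (\<lambda>v. \<Sum>E\<in>fst e. trace_from E (diff D) x *v trace_from E (grad v) x)"
    by (intro linear_form_on_sum
        linear_form_on_compose[OF matrix_vector_mul_linear linear_trace(2)[OF e(1) _ e(2)]])
  then show ?thesis
    unfolding flux_average_def average_def by (rule linear_form_on_compose[rotated]) (simp add: linear_iff algebra_simps)
qed

lemma bounded_measurable_flux_average:
  assumes e: "e \<in> faces D" and v: "v \<in> V_dG D"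
  shows "bounded_measurable (face_measure (snd e)) (flux_average D e v)"
  unfolding flux_average_def[abs_def] average_def
  by (intro bounded_measurable_sum bounded_measurable_scaleR bounded_measurable_matrix_vector
      bounded_measurable_trace(2)[OF e _ v] bounded_measurable_trace_diff[OF e] bounded_measurable_const)

text \<open>Moving the sign condition from the index set into the summands makes the set of summands independent of the point, as
measurability arguments require.\<close>

lemma downwind_trace_eq:
  assumes e: "e \<in> faces D"
  shows "downwind_trace D e v x =
    (\<Sum>E\<in>fst e. if conv D x \<bullet> outward_normal E (snd e) < 0 then trace_from E v x else 0)"
  unfolding downwind_trace_def by (rule sum.inter_filter[OF face_props(1)[OF e]])

lemma linear_downwind_trace:
  assumes e: "e \<in> faces D" "x \<in> snd e"
  shows "linear_form_on (V_dG D) (\<lambda>v. downwind_trace D e v x)"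
  unfolding downwind_trace_def by (intro linear_form_on_sum linear_trace(1)[OF e(1) _ e(2)]) auto

lemma bounded_measurable_downwind_trace:
  assumes e: "e \<in> faces D" and v: "v \<in> V_dG D"
  shows "bounded_measurable (face_measure (snd e)) (downwind_trace D e v)"
proof -
  have meas: "{x \<in> space (face_measure (snd e)). conv D x \<bullet> k < 0} \<in> sets (face_measure (snd e))" for k
  proof -
    have "(\<lambda>x. conv D x \<bullet> k) \<in> borel_measurable (face_measure (snd e))"
      using bounded_measurable_conv_face[OF e] unfolding bounded_measurable_def
      by (auto intro: borel_measurable_inner)
    then show ?thesis by measurable
  qed
  show ?thesis
    unfolding downwind_trace_eq[OF e, abs_def]
    by (intro bounded_measurable_sum bounded_measurable_if meas bounded_measurable_trace[OF e _ v])
qed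

lemma bilinear_elem_int:
  assumes E: "E \<in> T_h D"
    and "\<And>u v. u \<in> V_dG D \<Longrightarrow> v \<in> V_dG D \<Longrightarrow> bounded_measurable (lebesgue_on E) (f u v)"
    and "\<And>x. x \<in> E \<Longrightarrow> bilinear_form_on (V_dG D) (\<lambda>u v. f u v x)"
  shows "bilinear_form_on (V_dG D) (\<lambda>u v. elem_int E (f u v))"
  unfolding elem_int_def
  using assms by (intro bilinear_form_on_integral V_dG_subspace finite_measure_element) auto

lemma bilinear_face_int:
  assumes e: "e \<in> faces D"
    and "\<And>u v. u \<in> V_dG D \<Longrightarrow> v \<in> V_dG D \<Longrightarrow> bounded_measurable (face_measure (snd e)) (f u v)"
    and "\<And>x. x \<in> snd e \<Longrightarrow> bilinear_form_on (V_dG D) (\<lambda>u v. f u v x)"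
  shows "bilinear_form_on (V_dG D) (\<lambda>u v. face_int e (f u v))"
  unfolding face_int_def
  using assms by (intro bilinear_form_on_integral V_dG_subspace finite_measure_face) (auto simp: space_face_measure)

lemma bilinear_jump_jump:
  assumes e: "e \<in> faces D"
  shows "bilinear_form_on (V_dG D) (\<lambda>u v. face_int e (\<lambda>x. c * (jump e u x \<bullet> jump e v x)))"
  using e
  by (intro bilinear_face_int bounded_measurable_mult bounded_measurable_const bounded_measurable_inner
      bounded_measurable_jump bilinear_form_on_cmult bilinear_form_on_inner linear_jump)

lemma bilinear_form_d: "bilinear_form_on (V_dG D) (form_d D)"
proof -
  have "bilinear_form_on (V_dG D) (\<lambda>w v. elem_int E (\<lambda>x. (diff D x *v grad w x) \<bullet> grad v x))"
    if "E \<in> T_h D" for E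
    using that
    by (intro bilinear_elem_int bounded_measurable_inner bounded_measurable_matrix_vector
        bounded_measurable_diff_element bounded_measurable_V_element bilinear_form_on_inner
        linear_form_on_compose[OF matrix_vector_mul_linear] linear_element)
  moreover have "bilinear_form_on (V_dG D) (\<lambda>w v. face_int e (\<lambda>x.
        flux_average D e w x \<bullet> jump e v x - theta D * (flux_average D e v x \<bullet> jump e w x)))"
    if "e \<in> faces D" for e
    using that
    by (intro bilinear_face_int bounded_measurable_diff bounded_measurable_mult bounded_measurable_const
        bounded_measurable_inner bounded_measurable_jump bounded_measurable_flux_average
        bilinear_form_on_diff bilinear_form_on_cmult bilinear_form_on_inner
        bilinear_form_on_swap[OF bilinear_form_on_inner] linear_jump linear_flux_average)
  ultimately show ?thesis
    unfolding form_d_def[abs_def]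
    by (intro bilinear_form_on_diff bilinear_form_on_add bilinear_form_on_sum bilinear_jump_jump)
qed

lemma bilinear_form_ar: "bilinear_form_on (V_dG D) (form_ar D)"
proof -
  have "bilinear_form_on (V_dG D) (\<lambda>w v. elem_int E (\<lambda>x. (conv D x \<bullet> grad w x) * v x + reac D x * w x * v x))"
    if "E \<in> T_h D" for E
    using that
    by (intro bilinear_elem_int bounded_measurable_add bounded_measurable_mult bounded_measurable_inner
        bounded_measurable_conv_element bounded_measurable_reac_element bounded_measurable_V_element
        bilinear_form_on_add bilinear_form_on_mult linear_form_on_compose[OF bounded_linear.linear[OF bounded_linear_inner_right]]
        linear_form_on_compose[OF linear_times] linear_element)
  moreover have "bilinear_form_on (V_dG D) (\<lambda>w v. face_int e (\<lambda>x. (conv D x \<bullet> jump e w x) * downwind_trace D e v x))"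
    if "e \<in> faces D" for e
    using that
    by (intro bilinear_face_int bounded_measurable_mult bounded_measurable_inner bounded_measurable_conv_face
        bounded_measurable_jump bounded_measurable_downwind_trace bilinear_form_on_mult
        linear_form_on_compose[OF bounded_linear.linear[OF bounded_linear_inner_right]] linear_jump linear_downwind_trace)
  moreover have "bilinear_form_on (V_dG D) (\<lambda>w v. face_int e (\<lambda>x. \<Sum>E\<in>fst e.
        (conv D x \<bullet> outward_normal E (snd e)) * trace_from E w x * trace_from E v x))"
    if "e \<in> faces D" for e
    using that
    by (intro bilinear_face_int bounded_measurable_sum bounded_measurable_mult bounded_measurable_inner
        bounded_measurable_const bounded_measurable_conv_face bounded_measurable_trace bilinear_form_on_sum
        bilinear_form_on_mult linear_form_on_compose[OF linear_times] linear_trace)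
  moreover have "interior_faces D \<subseteq> faces D" "inflow_faces D \<subseteq> faces D"
    unfolding faces_def inflow_faces_def by auto
  ultimately show ?thesis
    unfolding form_ar_def[abs_def]
    by (intro bilinear_form_on_diff bilinear_form_on_sum) blast+
qed

lemma bilinear_form_B: "bilinear_form_on (V_dG D) (form_B D)"
  unfolding form_B_def[abs_def] by (intro bilinear_form_on_add bilinear_form_d bilinear_form_ar)

lemma cG_faces_subset: "cG_faces D \<subseteq> faces D"
  unfolding cG_faces_def by blast

lemma bilinear_form_S: "bilinear_form_on (V_dG D) (form_S D)"
  unfolding form_S_def[abs_def]
  using cG_faces_subset by (intro bilinear_form_on_sum bilinear_jump_jump) blast

text \<open>Such a face touches only elements of the continuous region. If it is a boundary face, the trace vanishes by
definition of the space; if it is an interior face, both traces are the value of the continuous extension and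
the normals cancel.\<close>

lemma jump_V_cdG:
  assumes v: "v \<in> V_cdG D" and e: "e \<in> cG_faces D" and x: "x \<in> snd e"
  shows "jump e v x = 0"
proof -
  have ef: "e \<in> faces D" using e cG_faces_subset by blast
  have "fst e \<inter> T_dG D = {}" using e ef unfolding cG_faces_def dG_faces_def by blast
  then have cG: "fst e \<subseteq> T_cG D" using face_props(2)[OF ef] unfolding T_h_def by blast
  have "e \<in> interior_faces D \<or> e \<in> boundary_faces D" using ef unfolding faces_def by blast
  then show ?thesis
  proof
    assume b: "e \<in> boundary_faces D"
    then have "e \<in> cG_boundary_faces D" using cG unfolding cG_boundary_faces_def by blast
    then have "trace_from E v x = 0" if "E \<in> fst e" for E
      using v x that unfolding V_cdG_def by blast
    then show ?thesis by (simp add: jump_def)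
  next
    assume "e \<in> interior_faces D"
    then obtain E1 E2 where E: "fst e = {E1, E2}" "snd e = closure E1 \<inter> closure E2" "E1 \<in> T_h D" "E2 \<in> T_h D"
      "E1 \<noteq> E2" "aff_dim (closure E1 \<inter> closure E2) = int CARD('n) - 1"
      by (rule interior_facesE)
    obtain g where g: "continuous_on (closure (\<Union>(T_cG D))) g" "\<forall>y\<in>\<Union>(T_cG D). v y = g y"
      using v unfolding V_cdG_def by blast
    have tr: "trace_from E' v x = g x" if E': "E' \<in> fst e" for E'
    proof (rule trace_from_eq)
      note on = on_face[OF ef E']
      show xE: "x \<in> closure E'" "x \<notin> E'" using on x by blast+
      have sub: "E' \<subseteq> \<Union>(T_cG D)" using cG E' by blast
      then have "x \<in> closure (\<Union>(T_cG D))" using xE(1) closure_mono by blast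
      then have "(g \<longlongrightarrow> g x) (at x within closure (\<Union>(T_cG D)))" using g(1) unfolding continuous_on_def by blast
      then have "(g \<longlongrightarrow> g x) (at x within E')"
        by (rule tendsto_within_subset) (use sub closure_subset in blast)
      then show "(v \<longlongrightarrow> g x) (at x within E')"
      proof (rule Lim_transform_eventually)
        have "g y = v y" if "y \<in> E'" for y using g(2) sub that by auto
        then show "eventually (\<lambda>y. g y = v y) (at x within E')" by (simp add: eventually_at_filter)
      qed
    qed
    have "E1 \<inter> E2 = {}"
      using mesh E(3,4,5) unfolding subdivision_def pairwise_def disjnt_def by blast
    then have "outward_normal E2 (snd e) = - outward_normal E1 (snd e)"
      using element_props(1-3)[OF E(3)] element_props(1-3)[OF E(4)] E(2,6)
      by (intro outward_normals_opposite) auto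
    then show ?thesis using tr E(1,5) by (simp add: jump_def)
  qed
qed

lemma form_S_V_cdG:
  assumes u: "u \<in> V_cdG D"
  shows "form_S D u v = 0" "form_S D v u = 0"
proof -
  have zero: "face_int e f = 0" if "\<And>x. x \<in> snd e \<Longrightarrow> f x = 0" for e :: "'n face" and f
    unfolding face_int_def using that
    by (subst Bochner_Integration.integral_cong[OF refl, of _ f "\<lambda>_. 0"]) (auto simp: space_face_measure)
  show "form_S D u v = 0" "form_S D v u = 0"
    unfolding form_S_def using jump_V_cdG[OF u] by (auto intro!: sum.neutral zero)
qed

lemma S_seminorm_square:
  assumes M: "\<forall>e\<in>faces D. 0 \<le> penalty_M D e"
  shows "form_S D v v = (S_seminorm D v)\<^sup>2"
proof -
  have M': "0 \<le> penalty_M D e" if "e \<in> cG_faces D" for e using M cG_faces_subset that by blast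
  have "(\<Sum>e\<in>cG_faces D. face_int e (\<lambda>x. (norm (sqrt (penalty_M D e) *\<^sub>R jump e v x))\<^sup>2)) = form_S D v v"
    unfolding form_S_def using M'
    by (intro sum.cong refl arg_cong[where f = "face_int _"] ext)
      (simp add: power_mult_distrib dot_square_norm)
  moreover have "0 \<le> form_S D v v"
    unfolding form_S_def face_int_def using M' by (intro sum_nonneg Bochner_Integration.integral_nonneg) auto
  ultimately show ?thesis by (simp add: S_seminorm_def)
qed

text \<open>The source is only square integrable, hence the inequality \<open>\<bar>a b\<bar> \<le> a\<^sup>2 + b\<^sup>2\<close> replaces boundedness.\<close>

lemma linear_form_l: "linear_form_on (V_dG D) (form_l D)"
proof -
  have "linear_form_on (V_dG D) (\<lambda>v. elem_int E (\<lambda>x. source D x * v x))" if E: "E \<in> T_h D" for E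
    unfolding elem_int_def
  proof (intro linear_form_on_integral V_dG_subspace)
    fix v assume v: "v \<in> V_dG D"
    have source: "source D \<in> borel_measurable (lebesgue_on E)"
      using f_L2 measurable_element[OF E] unfolding square_integrable_def by blast
    have \<Omega>: "Omega D \<in> sets lebesgue" using domain(1) by auto
    have "set_integrable lebesgue (Omega D) (\<lambda>x. (source D x)\<^sup>2)"
      using f_L2 \<Omega> unfolding square_integrable_def by (simp add: integrable_restrict_space set_integrable_def)
    then have "set_integrable lebesgue E (\<lambda>x. (source D x)\<^sup>2)"
      by (rule set_integrable_subset) (use element_props[OF E] in auto)
    then have sq: "integrable (lebesgue_on E) (\<lambda>x. (source D x)\<^sup>2)"
      using element_props(8)[OF E] by (simp add: integrable_restrict_space set_integrable_def)
    note bv = bounded_measurable_V_element(1)[OF E v]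
    have "integrable (lebesgue_on E) (\<lambda>x. v x * v x)"
      by (intro bounded_measurable_integrable finite_measure_element E bounded_measurable_mult bv)
    then have "integrable (lebesgue_on E) (\<lambda>x. (source D x)\<^sup>2 + v x * v x)"
      using sq by (rule Bochner_Integration.integrable_add[rotated])
    then show "integrable (lebesgue_on E) (\<lambda>x. source D x * v x)"
    proof (rule Bochner_Integration.integrable_bound)
      show "(\<lambda>x. source D x * v x) \<in> borel_measurable (lebesgue_on E)"
        using source bv unfolding bounded_measurable_def by (intro borel_measurable_times) auto
      have "\<bar>a * b\<bar> \<le> a\<^sup>2 + b * b" for a b :: real
      proof -
        have "2 * (\<bar>a\<bar> * \<bar>b\<bar>) \<le> a\<^sup>2 + b * b"
          using zero_le_power2[of "\<bar>a\<bar> - \<bar>b\<bar>"] by (simp add: power2_eq_square algebra_simps)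
        moreover have "0 \<le> \<bar>a\<bar> * \<bar>b\<bar>" by simp
        ultimately show ?thesis unfolding abs_mult by linarith
      qed
      then show "AE x in lebesgue_on E. norm (source D x * v x) \<le> norm ((source D x)\<^sup>2 + v x * v x)"
        by (intro AE_I2) (metis abs_ge_self order_trans real_norm_def)
    qed
  next
    fix x assume "x \<in> space (lebesgue_on E)"
    then show "linear_form_on (V_dG D) (\<lambda>v. source D x * v x)"
      by (intro linear_form_on_compose[OF linear_times] linear_element[OF E]) simp
  qed
  then show ?thesis unfolding form_l_def[abs_def] by (rule linear_form_on_sum)
qed

end

theorem theorem3p19:
  fixes D :: "('n::finite) cdg"
    and V_perp :: "(real^'n \<Rightarrow> real) set"
    and w :: "real \<Rightarrow> real^'n \<Rightarrow> real"
    and v_h :: "real^'n \<Rightarrow> real"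
    and \<tau> :: real
    and N :: "(real^'n \<Rightarrow> real) \<Rightarrow> real"
  assumes setting: "cdg_setting D"
    and V_perp: "subspace V_perp" "direct_sum (V_dG D) (V_cdG D) V_perp"
    and M_nonneg: "\<forall>e\<in>faces D. 0 \<le> penalty_M D e"
    and norm_dG: "norm_on (V_dG D) (dG_norm D)"
    and norm_S: "norm_on V_perp (S_seminorm D)"
    and coercive: "\<exists>\<Lambda>>0. \<forall>v\<in>V_dG D. form_B D v v \<ge> \<Lambda> * (dG_norm D v)\<^sup>2"
    and w_dG: "\<forall>\<sigma>\<ge>0. w \<sigma> \<in> V_dG D \<and> (\<forall>v\<in>V_dG D. form_B_sigma D \<sigma> (w \<sigma>) v = form_l D v)"
    and v_cdG: "0 \<le> \<tau>" "v_h \<in> V_cdG D" "\<forall>v\<in>V_cdG D. form_B_sigma D \<tau> v_h v = form_l D v"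
    and N: "norm_on (V_dG D) N"
  shows "((\<lambda>\<sigma>. N (w \<sigma> - v_h)) \<longlongrightarrow> 0) at_top"
proof -
  interpret cdg_setting D by (rule setting)
  obtain \<Lambda> where \<Lambda>: "\<Lambda> > 0" "\<And>v. v \<in> V_dG D \<Longrightarrow> \<Lambda> * (dG_norm D v)\<^sup>2 \<le> form_B D v v"
    using coercive by blast
  obtain G where G: "finite G" "V_dG D \<subseteq> span G" using V_dG_finite_dim[OF mesh] by blast
  show ?thesis
  proof (rule penalty_limit[OF V_dG_subspace G V_perp bilinear_form_B bilinear_form_S linear_form_l
        form_S_V_cdG S_seminorm_square[OF M_nonneg] norm_dG norm_S N \<Lambda>])
    show "w \<sigma> \<in> V_dG D" if "\<sigma> \<ge> 0" for \<sigma> using w_dG that by blast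
    show "form_B D (w \<sigma>) v + \<sigma> * form_S D (w \<sigma>) v = form_l D v" if "\<sigma> \<ge> 0" "v \<in> V_dG D" for \<sigma> v
      using w_dG that unfolding form_B_sigma_def by blast
    show "v_h \<in> V_cdG D" by (rule v_cdG(2))
    show "form_B D v_h v = form_l D v" if "v \<in> V_cdG D" for v
      using v_cdG(3) that form_S_V_cdG(1)[OF v_cdG(2)] by (simp add: form_B_sigma_def)
  qed
qed

end
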